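(* For an application with a dataset of $N$ files, and $K$ users that each can store a fraction $\mu$ of the files, the decentralized coded wireless distributed computing (CWDC) scheme (described in full in the context) achieves, with high probability for sufficiently large $N$, an information loss $$\Delta=(1-\mu)^K$$ and the uplink and downlink communication loads $$L_{\mathrm{decent},u}^{\mathrm{coded}}=\sum_{j=1}^{K-1}\binom{K}{j+1}\frac{j+1}{j}\,\mu^j(1-\mu)^{K-j},$$ $$L_{\mathrm{decent},d}^{\mathrm{coded}}=\sum_{j=1}^{K-1}\binom{K}{j+1}\mu^j(1-\mu)^{K-j}.$$
   Context: Model. A random and a priori unknown set of users takes part in a computation; let there be $K$ participating users, labelled $1,\ldots,K$, with $\frac1K\le\mu<1$. They are connected wirelessly to an access point that has no access to the dataset. The dataset has $N$ files indexed by $\{1,\ldots,N\}$. Before the computation, and without knowing who will participate, each user independently stores a random subset of $\mu N$ files according to a common placement distribution; $\mathcal U_k$ is the set of indices of files stored by user $k$. The information loss $\Delta$ is the fraction of the $N$ files not stored by any participating user. Once the computation starts, the participating users are fixed and known to each other, and they compute over the available files $\bigcup_{k}\mathcal U_k$ only. User $k$ has an input $d_k$, known to all participating users; for each file $w_n$ there is a $T$-bit intermediate value $v_{k,n}=g_n(d_k;w_n)$, where $g_n$ is a Map function, and user $k$ needs $v_{k,n}$ for all available $n$. User $k$ computes locally $\{v_{q,n}:q\in\{1,\ldots,K\},\,n\in\mathcal U_k\}$. In the uplink, each user sends the access point a message that is a function of its local values; in the downlink, the access point broadcasts to all users a message that is a function of the uplink messages; each user then recovers the values it needs from the broadcast and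 its local values. The uplink load is the total number of uplink bits divided by $NT$, and the downlink load is the number of bits in the broadcast message divided by $NT$. The decentralized CWDC scheme. Placement: every user independently stores $\mu N$ files chosen uniformly at random. Uplink: for $\mathcal W\subset\{1,\ldots,K\}$ and $k\notin\mathcal W$, let $\mathcal V^k_{\mathcal W}=\{v_{k,n}:n\in\bigcap_{i\in\mathcal W}\mathcal U_i,\ n\notin\bigcup_{i\notin\mathcal W}\mathcal U_i\}$ be the values needed by user $k$ and known exclusively by the users in $\mathcal W$. For every subset $\mathcal S\subseteq\{1,\ldots,K\}$ with $|\mathcal S|\ge2$ and every $k\in\mathcal S$, split $\mathcal V^k_{\mathcal S\setminus\{k\}}$ evenly and arbitrarily into $|\mathcal S|-1$ disjoint segments $\mathcal V^k_{\mathcal S\setminus\{k\},i}$, $i\in\mathcal S\setminus\{k\}$. Each user $i\in\mathcal S$ sends the bit-wise XOR $W_i^{\mathcal S}=\bigoplus_{k\in\mathcal S\setminus\{i\}}\mathcal V^k_{\mathcal S\setminus\{k\},i}$, where the segments being XORed are zero-padded to the maximum length among them. Downlink: for every subset $\mathcal S\subseteq\{1,\ldots,K\}$ with $|\mathcal S|\ge2$, the access point computes $|\mathcal S|-1$ random linear combinations of the messages $\{W_i^{\mathcal S}:i\in\mathcal S\}$ and multicasts them to all users in $\mathcal S$. Meaning of the stated equalities: under this placement, the number of files stored exclusively by all users of a set $\mathcal S$ is $\mu^{|\mathcal S|}(1-\mu)^{K-|\mathcal S|}N+o(N)$, and the values of $\Delta$ and of the loads are to be read as holding, with high probability, up to terms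 vanishing as $N\to\infty$. *)

theory Defs
  imports "HOL-Probability.Probability" "HOL-Algebra.Ring"
begin

text \<open>
  Users are \<open>1,\<dots>,K\<close> and files are \<open>1,\<dots>,N\<close>. A placement maps a user to the set of files it
  stores; a value table \<open>v\<close> maps a user \<open>k\<close> and a file \<open>n\<close> to the bits of \<open>v k n\<close>.
\<close>

type_synonym placement = "nat \<Rightarrow> nat set"
type_synonym value_table = "nat \<Rightarrow> nat \<Rightarrow> bool list"

text \<open>The segmentation \<open>seg S k i\<close> is the segment, assigned to user \<open>i\<close>, of the values needed by
  user \<open>k\<close> and known exclusively by \<open>S - {k}\<close>. These values are represented by their file indices.\<close>

type_synonym segmentation = "nat set \<Rightarrow> nat \<Rightarrow> nat \<Rightarrow> nat set"


subsection \<open>Model\<close>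

definition intermediate_values ::
    "(nat \<Rightarrow> 'd \<Rightarrow> 'w \<Rightarrow> bool list) \<Rightarrow> (nat \<Rightarrow> 'd) \<Rightarrow> (nat \<Rightarrow> 'w) \<Rightarrow> value_table" where
  "intermediate_values g d w = (\<lambda>k n. g n (d k) (w n))"

definition available_files :: "nat \<Rightarrow> placement \<Rightarrow> nat set" where
  "available_files K U = (\<Union>k\<in>{1..K}. U k)"

definition information_loss :: "nat \<Rightarrow> nat \<Rightarrow> placement \<Rightarrow> real" where
  "information_loss K N U = real (card ({1..N} - available_files K U)) / real N"

text \<open>The values user \<open>i\<close> computes locally. Entries it cannot compute are blanked out, so anything
  computed from \<open>local_values K U i v\<close> is a function of its local values.\<close>

definition local_values :: "nat \<Rightarrow> placement \<Rightarrow> nat \<Rightarrow> value_table \<Rightarrow> value_table" where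
  "local_values K U i v = (\<lambda>q n. if q \<in> {1..K} \<and> n \<in> U i then v q n else [])"


subsection \<open>Placement\<close>

text \<open>Each user stores \<open>\<lfloor>\<mu>N\<rfloor>\<close> files; this is \<open>\<mu>N\<close> whenever \<open>\<mu>N\<close> is an integer. The law of a single
  user's placement does not depend on \<open>K\<close>.\<close>

definition user_placement_pmf :: "real \<Rightarrow> nat \<Rightarrow> nat set pmf" where
  "user_placement_pmf \<mu> N = pmf_of_set {A. A \<subseteq> {1..N} \<and> card A = nat \<lfloor>\<mu> * real N\<rfloor>}"

definition placement_pmf :: "nat \<Rightarrow> real \<Rightarrow> nat \<Rightarrow> placement pmf" where
  "placement_pmf K \<mu> N = Pi_pmf {1..K} {} (\<lambda>_. user_placement_pmf \<mu> N)"


subsection \<open>Uplink\<close>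

definition groups :: "nat \<Rightarrow> nat set set" where
  "groups K = {S. S \<subseteq> {1..K} \<and> card S \<ge> 2}"

definition exclusive_files :: "nat \<Rightarrow> placement \<Rightarrow> nat set \<Rightarrow> nat set" where
  "exclusive_files K U W = (\<Inter>i\<in>W. U i) - (\<Union>i\<in>{1..K} - W. U i)"

text \<open>Even splits are even up to one value, since the number of values need not be divisible.\<close>

definition even_segmentation :: "nat \<Rightarrow> placement \<Rightarrow> segmentation \<Rightarrow> bool" where
  "even_segmentation K U seg \<longleftrightarrow>
     (\<forall>S\<in>groups K. \<forall>k\<in>S.
        (\<Union>i\<in>S - {k}. seg S k i) = exclusive_files K U (S - {k}) \<and>
        disjoint_family_on (seg S k) (S - {k}) \<and>
        (\<forall>i\<in>S - {k}. \<forall>j\<in>S - {k}. card (seg S k i) \<le> card (seg S k j) + 1))"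

definition zero_pad :: "nat \<Rightarrow> bool list \<Rightarrow> bool list" where
  "zero_pad L x = x @ replicate (L - length x) False"

definition max_length :: "nat set \<Rightarrow> (nat \<Rightarrow> bool list) \<Rightarrow> nat" where
  "max_length I x = Max ((\<lambda>i. length (x i)) ` I)"

text \<open>Bit-wise XOR of the strings \<open>x i\<close>, zero-padded to the maximum length among them.\<close>

definition padded_xor :: "nat set \<Rightarrow> (nat \<Rightarrow> bool list) \<Rightarrow> bool list" where
  "padded_xor I x =
     map (\<lambda>t. odd (card {i \<in> I. zero_pad (max_length I x) (x i) ! t})) [0..<max_length I x]"

definition segment_bits :: "segmentation \<Rightarrow> value_table \<Rightarrow> nat set \<Rightarrow> nat \<Rightarrow> nat \<Rightarrow> bool list" where
  "segment_bits seg v S k i = concat (map (v k) (sorted_list_of_set (seg S k i)))"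

text \<open>\<open>uplink_message K U seg v S i\<close> is the message \<open>W\<close> sent by user \<open>i\<close> for the group \<open>S\<close>.\<close>

definition uplink_message ::
    "nat \<Rightarrow> placement \<Rightarrow> segmentation \<Rightarrow> value_table \<Rightarrow> nat set \<Rightarrow> nat \<Rightarrow> bool list" where
  "uplink_message K U seg v S i =
     padded_xor (S - {i}) (\<lambda>k. segment_bits seg (local_values K U i v) S k i)"

definition uplink_load ::
    "nat \<Rightarrow> nat \<Rightarrow> nat \<Rightarrow> placement \<Rightarrow> segmentation \<Rightarrow> value_table \<Rightarrow> real" where
  "uplink_load K N T U seg v =
     real (\<Sum>S\<in>groups K. \<Sum>i\<in>S. length (uplink_message K U seg v S i)) / (real N * real T)"


subsection \<open>Downlink\<close>

text \<open>The linear combinations are taken over a finite field \<open>F\<close> with \<open>2 ^ r\<close> elements, whose elements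
  are labelled by \<open>r\<close>-bit strings through \<open>lab\<close>. A message is zero-padded to a multiple of \<open>r\<close> bits and
  read block by block as a vector over \<open>F\<close>; combinations are sent as bit strings again.\<close>

definition field_labelling :: "nat \<Rightarrow> 'f ring \<Rightarrow> (bool list \<Rightarrow> 'f) \<Rightarrow> bool" where
  "field_labelling r F lab \<longleftrightarrow> field F \<and> bij_betw lab {b. length b = r} (carrier F)"

definition num_blocks :: "nat \<Rightarrow> nat \<Rightarrow> nat" where
  "num_blocks r L = nat \<lceil>real L / real r\<rceil>"

definition block :: "nat \<Rightarrow> nat \<Rightarrow> bool list \<Rightarrow> nat \<Rightarrow> bool list" where
  "block r L x p = take r (drop (p * r) (zero_pad (num_blocks r L * r) x))"

definition linear_combination ::
    "nat \<Rightarrow> 'f ring \<Rightarrow> (bool list \<Rightarrow> 'f) \<Rightarrow> nat set \<Rightarrow> (nat \<Rightarrow> 'f) \<Rightarrow> (nat \<Rightarrow> bool list) \<Rightarrow> bool list" where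
  "linear_combination r F lab S c x =
     (let L = max_length S x in
      concat (map (\<lambda>p. inv_into {b. length b = r} lab
                         (\<Oplus>\<^bsub>F\<^esub>i\<in>S. c i \<otimes>\<^bsub>F\<^esub> lab (block r L (x i) p)))
                  [0..<num_blocks r L]))"

text \<open>The coefficient \<open>c (S, j, i)\<close> multiplies the message of user \<open>i\<close> in the \<open>j\<close>-th combination for the
  group \<open>S\<close>.\<close>

definition coefficient_indices :: "nat \<Rightarrow> (nat set \<times> nat \<times> nat) set" where
  "coefficient_indices K = {(S, j, i). S \<in> groups K \<and> j < card S - 1 \<and> i \<in> S}"

definition coefficients_pmf :: "nat \<Rightarrow> 'f ring \<Rightarrow> (nat set \<times> nat \<times> nat \<Rightarrow> 'f) pmf" where
  "coefficients_pmf K F = Pi_pmf (coefficient_indices K) \<zero>\<^bsub>F\<^esub> (\<lambda>_. pmf_of_set (carrier F))"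

text \<open>\<open>downlink_message r F lab c K x S j\<close> is the \<open>j\<close>-th combination multicast to the group \<open>S\<close>, computed
  from the received uplink messages \<open>x\<close>.\<close>

definition downlink_message ::
    "nat \<Rightarrow> 'f ring \<Rightarrow> (bool list \<Rightarrow> 'f) \<Rightarrow> (nat set \<times> nat \<times> nat \<Rightarrow> 'f) \<Rightarrow> nat \<Rightarrow>
     (nat set \<Rightarrow> nat \<Rightarrow> bool list) \<Rightarrow> nat set \<Rightarrow> nat \<Rightarrow> bool list" where
  "downlink_message r F lab c K x S j =
     (if S \<in> groups K \<and> j < card S - 1
      then linear_combination r F lab S (\<lambda>i. c (S, j, i)) (x S) else [])"

definition downlink_load ::
    "nat \<Rightarrow> nat \<Rightarrow> nat \<Rightarrow> (nat set \<Rightarrow> nat \<Rightarrow> bool list) \<Rightarrow> real" where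
  "downlink_load K N T y =
     real (\<Sum>S\<in>groups K. \<Sum>j<card S - 1. length (y S j)) / (real N * real T)"


subsection \<open>The scheme\<close>

definition broadcast ::
    "nat \<Rightarrow> nat \<Rightarrow> 'f ring \<Rightarrow> (bool list \<Rightarrow> 'f) \<Rightarrow> segmentation \<Rightarrow> placement \<Rightarrow>
     (nat set \<times> nat \<times> nat \<Rightarrow> 'f) \<Rightarrow> value_table \<Rightarrow> nat set \<Rightarrow> nat \<Rightarrow> bool list" where
  "broadcast K r F lab seg U c v =
     downlink_message r F lab c K (uplink_message K U seg v)"

text \<open>The decoder may depend on the placement, the segmentation, the coefficients, the Map functions
  and the inputs, but must work for every dataset \<open>w\<close>.\<close>

definition user_recovers ::
    "nat \<Rightarrow> nat \<Rightarrow> 'f ring \<Rightarrow> (bool list \<Rightarrow> 'f) \<Rightarrow> segmentation \<Rightarrow> placement \<Rightarrow>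
     (nat set \<times> nat \<times> nat \<Rightarrow> 'f) \<Rightarrow> (nat \<Rightarrow> 'd \<Rightarrow> 'w \<Rightarrow> bool list) \<Rightarrow> (nat \<Rightarrow> 'd) \<Rightarrow> nat \<Rightarrow> bool" where
  "user_recovers K r F lab seg U c g d k \<longleftrightarrow>
     (\<exists>dec. \<forall>w. \<forall>n\<in>available_files K U.
        dec (broadcast K r F lab seg U c (intermediate_values g d w))
            (local_values K U k (intermediate_values g d w)) n
        = intermediate_values g d w k n)"

definition coded_uplink_load :: "nat \<Rightarrow> real \<Rightarrow> real" where
  "coded_uplink_load K \<mu> =
     (\<Sum>j=1..K-1. real (K choose (j+1)) * (real (j+1) / real j) * \<mu> ^ j * (1 - \<mu>) ^ (K - j))"

definition coded_downlink_load :: "nat \<Rightarrow> real \<Rightarrow> real" where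
  "coded_downlink_load K \<mu> =
     (\<Sum>j=1..K-1. real (K choose (j+1)) * \<mu> ^ j * (1 - \<mu>) ^ (K - j))"

end

theory Submission
  imports Defs
begin

text \<open>
  Placement: the number of files stored exactly by the users in \<open>W\<close> is a sum of \<open>N\<close> indicators that are
  asymptotically pairwise uncorrelated, since a user's \<open>m\<close>-subset contains a given pair of files with
  probability \<open>m (m - 1) / (N (N - 1))\<close>. Chebyshev's argument then bounds the deviation of its fraction
  from \<open>\<mu> ^ card W * (1 - \<mu>) ^ (K - card W)\<close>, for all of the finitely many \<open>W\<close> at once. On this event
  every message of a group of size \<open>s\<close> has length \<open>\<mu> ^ (s - 1) * (1 - \<mu>) ^ (K - s + 1) / (s - 1)\<close>, in
  units of \<open>N T\<close> and up to a small error, and summing over the groups gives both loads.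

  Decoding: user \<open>k\<close> of a group \<open>S\<close> knows its own message, so the combinations determine the others
  unless the square matrix of coefficients with columns \<open>S - {k}\<close> has a nonzero kernel vector. A
  union bound over kernel vectors with some entry \<open>1\<close> shows that this has probability at most
  \<open>(card S - 1) / 2 ^ r\<close>. From the message of a user \<open>i\<close> the user \<open>k\<close> removes the segments of the other
  users, all of which it stores, and obtains its own segment.
\<close>

section \<open>Placement\<close>

lemma card_subsets_containing:
  assumes "finite X" "B \<subseteq> X" "card B \<le> m"
  shows "card {A. A \<subseteq> X \<and> card A = m \<and> B \<subseteq> A} = (card X - card B) choose (m - card B)"
proof -
  have fB: "finite B" using assms finite_subset by auto
  have "bij_betw (\<lambda>A. A - B) {A. A \<subseteq> X \<and> card A = m \<and> B \<subseteq> A}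
          {A. A \<subseteq> X - B \<and> card A = m - card B}"
  proof (rule bij_betwI[where g = "\<lambda>A. A \<union> B"], goal_cases)
    case 1 then show ?case
      using fB by (auto simp: card_Diff_subset)
  next
    case 2
    have "card (A \<union> B) = m" if "A \<subseteq> X - B" "card A = m - card B" for A
    proof -
      have "finite A" using that assms finite_subset by blast
      then show ?thesis using that fB assms by (subst card_Un_disjoint) auto
    qed
    then show ?case using assms by auto
  next
    case 3 then show ?case by auto
  next
    case 4 then show ?case by auto
  qed
  then have "card {A. A \<subseteq> X \<and> card A = m \<and> B \<subseteq> A} = card {A. A \<subseteq> X - B \<and> card A = m - card B}"
    by (rule bij_betw_same_card)
  also have "\<dots> = card (X - B) choose (m - card B)"
    using assms by (intro n_subsets) auto
  finally show ?thesis
    using assms fB by (simp add: card_Diff_subset)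
qed

definition storage_size :: "real \<Rightarrow> nat \<Rightarrow> nat" where
  "storage_size \<mu> N = nat \<lfloor>\<mu> * real N\<rfloor>"

lemma storage_size_le:
  assumes "\<mu> < 1"
  shows "storage_size \<mu> N \<le> N"
proof -
  have "\<mu> * real N \<le> 1 * real N" using assms by (intro mult_right_mono) auto
  then show ?thesis unfolding storage_size_def by linarith
qed

lemma storage_size_ratio_tendsto:
  assumes "0 < \<mu>"
  shows "(\<lambda>N. real (storage_size \<mu> N) / real N) \<longlonglongrightarrow> \<mu>"
proof -
  have lower: "(\<lambda>N::nat. \<mu> - 1 / real N) \<longlonglongrightarrow> \<mu>"
    by real_asymp
  have floor: "real (storage_size \<mu> N) \<le> \<mu> * real N \<and> \<mu> * real N - 1 \<le> real (storage_size \<mu> N)" for N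
    using assms unfolding storage_size_def by (simp add: of_nat_nat)
  show ?thesis
  proof (rule tendsto_sandwich[OF _ _ lower tendsto_const])
    show "\<forall>\<^sub>F N in sequentially. \<mu> - 1 / real N \<le> real (storage_size \<mu> N) / real N"
      using eventually_gt_at_top[of 0]
    proof eventually_elim
      case (elim N)
      have "\<mu> - 1 / real N = (\<mu> * real N - 1) / real N" using elim by (simp add: field_simps)
      also have "\<dots> \<le> real (storage_size \<mu> N) / real N"
        using floor[of N] by (intro divide_right_mono) auto
      finally show ?case .
    qed
    show "\<forall>\<^sub>F N in sequentially. real (storage_size \<mu> N) / real N \<le> \<mu>"
      using eventually_gt_at_top[of 0]
      by eventually_elim (use floor in \<open>simp add: field_simps\<close>)
  qed
qed

lemma storage_sets_nonempty:
  assumes "\<mu> < 1"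
  shows "{A. A \<subseteq> {1..N} \<and> card A = storage_size \<mu> N} \<noteq> {}"
  using obtain_subset_with_card_n[of "storage_size \<mu> N" "{1..N}"] storage_size_le[OF assms]
  by (metis (mono_tags, lifting) card_atLeastAtMost diff_Suc_1 empty_iff mem_Collect_eq)

lemma finite_storage_sets: "finite {A. A \<subseteq> {1..N::nat} \<and> card A = m}"
  by (rule finite_subset[of _ "Pow {1..N}"]) auto

lemma set_user_placement_pmf:
  assumes "\<mu> < 1"
  shows "set_pmf (user_placement_pmf \<mu> N) = {A. A \<subseteq> {1..N} \<and> card A = storage_size \<mu> N}"
  using storage_sets_nonempty[OF assms] finite_storage_sets
  unfolding user_placement_pmf_def storage_size_def by (intro set_pmf_of_set)

text \<open>All storage sets are equally likely, so the probability is a quotient of two counts. The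
  bound on \<open>card B\<close> keeps the truncated subtraction
  \<open>storage_size \<mu> N - card B\<close> exact.\<close>

lemma prob_user_stores_all:
  assumes "\<mu> < 1" "B \<subseteq> {1..N}" "card B \<le> storage_size \<mu> N"
  shows "measure_pmf.prob (user_placement_pmf \<mu> N) {A. B \<subseteq> A} =
    real ((N - card B) choose (storage_size \<mu> N - card B)) / real (N choose storage_size \<mu> N)"
proof -
  have "measure_pmf.prob (user_placement_pmf \<mu> N) {A. B \<subseteq> A} =
      real (card ({A. A \<subseteq> {1..N} \<and> card A = storage_size \<mu> N} \<inter> {A. B \<subseteq> A}))
        / real (card {A. A \<subseteq> {1..N} \<and> card A = storage_size \<mu> N})"
    using storage_sets_nonempty[OF assms(1)] finite_storage_sets
    unfolding user_placement_pmf_def storage_size_def by (intro measure_pmf_of_set)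
  also have "{A. A \<subseteq> {1..N} \<and> card A = storage_size \<mu> N} \<inter> {A. B \<subseteq> A} =
      {A. A \<subseteq> {1..N} \<and> card A = storage_size \<mu> N \<and> B \<subseteq> A}" by auto
  finally show ?thesis
    using assms by (simp add: card_subsets_containing n_subsets)
qed

lemma choose_absorption_ratio:
  assumes "1 \<le> m" "m \<le> N"
  shows "real ((N - 1) choose (m - 1)) / real (N choose m) = real m / real N"
proof -
  have "m * (N choose m) = N * ((N - 1) choose (m - 1))"
    using assms by (intro times_binomial_minus1_eq) auto
  then have "real m * real (N choose m) = real N * real ((N - 1) choose (m - 1))"
    by (metis of_nat_mult)
  moreover have "real (N choose m) > 0" using assms by (simp add: zero_less_binomial)
  ultimately show ?thesis using assms by (simp add: field_simps)
qed

lemma prob_user_stores: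
  assumes "\<mu> < 1" "n \<in> {1..N}" "1 \<le> storage_size \<mu> N"
  shows "measure_pmf.prob (user_placement_pmf \<mu> N) {A. n \<in> A} = real (storage_size \<mu> N) / real N"
  using prob_user_stores_all[of \<mu> "{n}" N] assms
    choose_absorption_ratio[OF assms(3) storage_size_le[OF assms(1)]] by simp

lemma prob_user_stores_pair:
  assumes "\<mu> < 1" "n \<in> {1..N}" "n' \<in> {1..N}" "n \<noteq> n'" "2 \<le> storage_size \<mu> N"
  shows "measure_pmf.prob (user_placement_pmf \<mu> N) {A. n \<in> A \<and> n' \<in> A} =
    real (storage_size \<mu> N) / real N * (real (storage_size \<mu> N - 1) / real (N - 1))"
proof -
  let ?m = "storage_size \<mu> N"
  have m: "?m \<le> N" by (rule storage_size_le[OF assms(1)])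
  have c: "card {n, n'} = 2" using assms by simp
  have "measure_pmf.prob (user_placement_pmf \<mu> N) {A. n \<in> A \<and> n' \<in> A} =
      real ((N - 2) choose (?m - 2)) / real (N choose ?m)"
    using prob_user_stores_all[of \<mu> "{n, n'}" N] assms c by simp
  \<comment> \<open>The factor \<open>(N - 1) choose (?m - 1)\<close> is inserted and cancels, so
    that absorption applies to each of the two quotients.\<close>
  also have "\<dots> = real ((N - 1) choose (?m - 1)) / real (N choose ?m) *
      (real ((N - 1 - 1) choose (?m - 1 - 1)) / real ((N - 1) choose (?m - 1)))"
    using assms m by (simp add: zero_less_binomial numeral_2_eq_2)
  also have "\<dots> = real ?m / real N * (real (?m - 1) / real (N - 1))"
    using assms m by (subst (1 2) choose_absorption_ratio) auto
  finally show ?thesis .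
qed

section \<open>Second moment and concentration of the stored fractions\<close>

lemma count_second_moment:
  fixes E :: "'n \<Rightarrow> 'x set" and b p :: real
  assumes M: "finite (set_pmf M)" and A: "finite A"
  shows "measure_pmf.expectation M (\<lambda>x. (real (card {n\<in>A. x \<in> E n}) / b - p)\<^sup>2) =
    (\<Sum>n\<in>A. \<Sum>n'\<in>A. measure_pmf.prob M (E n \<inter> E n')) / b\<^sup>2
      - 2 * p * (\<Sum>n\<in>A. measure_pmf.prob M (E n)) / b + p\<^sup>2"
proof -
  note int [simp] = integrable_measure_pmf_finite[OF M]
  define X where "X x = (\<Sum>n\<in>A. indicator (E n) x :: real)" for x
  have X: "real (card {n\<in>A. x \<in> E n}) = X x" for x
    using A unfolding X_def by (simp add: indicator_def sum.If_cases Int_def)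
  have X2: "X x * X x = (\<Sum>n\<in>A. \<Sum>n'\<in>A. indicator (E n \<inter> E n') x)" for x
    unfolding X_def by (simp add: sum_product indicator_inter_arith)
  have EX: "measure_pmf.expectation M X = (\<Sum>n\<in>A. measure_pmf.prob M (E n))"
    unfolding X_def by (subst Bochner_Integration.integral_sum) auto
  have EX2: "measure_pmf.expectation M (\<lambda>x. X x * X x) =
      (\<Sum>n\<in>A. \<Sum>n'\<in>A. measure_pmf.prob M (E n \<inter> E n'))"
    unfolding X2 by (subst Bochner_Integration.integral_sum, simp)+ simp
  \<comment> \<open>The square is expanded around an arbitrary centre \<open>p\<close>, not around
    the mean: later \<open>p\<close> is the limit of the mean as \<open>N\<close> grows.\<close>
  have "measure_pmf.expectation M (\<lambda>x. (real (card {n\<in>A. x \<in> E n}) / b - p)\<^sup>2) =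
      measure_pmf.expectation M (\<lambda>x. (1 / b\<^sup>2) * (X x * X x) - (2 * p / b) * X x + p\<^sup>2)"
    unfolding X by (intro Bochner_Integration.integral_cong)
      (auto simp: power2_eq_square field_simps diff_divide_distrib add_divide_distrib)
  also have "\<dots> = (1 / b\<^sup>2) * measure_pmf.expectation M (\<lambda>x. X x * X x)
      - (2 * p / b) * measure_pmf.expectation M X + p\<^sup>2"
    by simp
  finally show ?thesis unfolding EX EX2 by simp
qed

text \<open>The restriction to \<open>{1..N}\<close> lets this cover \<open>W = {}\<close>, where it
  gives the lost files. There \<open>exclusive_files\<close> would be of no use, as the intersection
  over the empty set is the whole type.\<close>

definition stored_exactly_by :: "nat \<Rightarrow> nat \<Rightarrow> placement \<Rightarrow> nat set \<Rightarrow> nat set" where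
  "stored_exactly_by K N U W = {n \<in> {1..N}. \<forall>k\<in>{1..K}. n \<in> U k \<longleftrightarrow> k \<in> W}"

lemma finite_set_placement_pmf:
  assumes "\<mu> < 1"
  shows "finite (set_pmf (placement_pmf K \<mu> N))"
proof -
  have "finite (set_pmf (user_placement_pmf \<mu> N))"
    by (simp add: set_user_placement_pmf[OF assms] finite_storage_sets)
  then show ?thesis
    unfolding placement_pmf_def by (subst set_Pi_pmf) (auto intro!: finite_PiE_dflt)
qed

lemma set_placement_pmf_subset:
  assumes "\<mu> < 1" "U \<in> set_pmf (placement_pmf K \<mu> N)" "k \<in> {1..K}"
  shows "U k \<subseteq> {1..N}"
  using assms(2,3) set_user_placement_pmf[OF assms(1), of N]
  unfolding placement_pmf_def by (subst (asm) set_Pi_pmf) (auto simp: PiE_dflt_def)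

lemma prob_placement_Pi:
  "measure_pmf.prob (placement_pmf K \<mu> N) {U. \<forall>k\<in>{1..K}. U k \<in> B k} =
    (\<Prod>k\<in>{1..K}. measure_pmf.prob (user_placement_pmf \<mu> N) (B k))"
  using measure_Pi_pmf_Pi[of "{1..K}" "{}" "\<lambda>_. user_placement_pmf \<mu> N" B]
  by (simp add: placement_pmf_def Pi_def Ball_def)

lemma prob_user_pattern:
  assumes "\<mu> < 1" "n \<in> {1..N}" "1 \<le> storage_size \<mu> N"
  shows "measure_pmf.prob (user_placement_pmf \<mu> N) {A. n \<in> A \<longleftrightarrow> b} =
    (if b then real (storage_size \<mu> N) / real N else 1 - real (storage_size \<mu> N) / real N)"
proof -
  have "{A. n \<notin> A} = space (measure_pmf (user_placement_pmf \<mu> N)) - {A. n \<in> A}" by auto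
  then show ?thesis
    using measure_pmf.prob_compl[of "{A. n \<in> A}" "user_placement_pmf \<mu> N"] prob_user_stores[OF assms]
    by simp
qed

text \<open>If both files are stored by exactly the users in \<open>W\<close>, they show the same
  pattern \<open>b\<close> at every user, so the mixed patterns never occur. For \<open>b\<close>
  false the value comes from inclusion-exclusion on the complement.\<close>

lemma prob_user_pattern_pair:
  assumes "\<mu> < 1" "n \<in> {1..N}" "n' \<in> {1..N}" "n \<noteq> n'" "2 \<le> storage_size \<mu> N"
  defines "m \<equiv> storage_size \<mu> N"
  shows "measure_pmf.prob (user_placement_pmf \<mu> N) {A. (n \<in> A \<longleftrightarrow> b) \<and> (n' \<in> A \<longleftrightarrow> b)} =
    (if b then real m / real N * (real (m - 1) / real (N - 1))
     else 1 - 2 * (real m / real N) + real m / real N * (real (m - 1) / real (N - 1)))"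
proof (cases b)
  case True
  then show ?thesis using prob_user_stores_pair[OF assms(1-5)] by (simp add: m_def)
next
  case False
  let ?M = "user_placement_pmf \<mu> N"
  have "measure_pmf.prob ?M {A. n \<notin> A \<and> n' \<notin> A} =
      measure_pmf.prob ?M (space (measure_pmf ?M) - ({A. n \<in> A} \<union> {A. n' \<in> A}))"
    by (rule arg_cong[where f = "measure_pmf.prob ?M"]) auto
  also have "\<dots> = 1 - measure_pmf.prob ?M ({A. n \<in> A} \<union> {A. n' \<in> A})"
    by (rule measure_pmf.prob_compl) simp
  also have "measure_pmf.prob ?M ({A. n \<in> A} \<union> {A. n' \<in> A}) =
      measure_pmf.prob ?M {A. n \<in> A} + measure_pmf.prob ?M {A. n' \<in> A}
        - measure_pmf.prob ?M ({A. n \<in> A} \<inter> {A. n' \<in> A})"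
    by (rule measure_Un3) (simp_all add: measure_pmf.fmeasurable_eq_sets)
  finally show ?thesis
    using False prob_user_stores[OF assms(1,2)] prob_user_stores[OF assms(1,3)]
      prob_user_stores_pair[OF assms(1-5)] assms(5)
    by (simp add: m_def Int_def)
qed

lemma prob_stored_exactly_by:
  assumes "\<mu> < 1" "n \<in> {1..N}" "1 \<le> storage_size \<mu> N"
  shows "measure_pmf.prob (placement_pmf K \<mu> N) {U. n \<in> stored_exactly_by K N U W} =
    (\<Prod>k\<in>{1..K}. if k \<in> W then real (storage_size \<mu> N) / real N else 1 - real (storage_size \<mu> N) / real N)"
proof -
  have "{U. n \<in> stored_exactly_by K N U W} = {U. \<forall>k\<in>{1..K}. U k \<in> {A. n \<in> A \<longleftrightarrow> k \<in> W}}"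
    using assms by (auto simp: stored_exactly_by_def)
  then show ?thesis by (simp only: prob_placement_Pi prob_user_pattern[OF assms])
qed

lemma prob_stored_exactly_by_pair:
  assumes "\<mu> < 1" "n \<in> {1..N}" "n' \<in> {1..N}" "n \<noteq> n'" "2 \<le> storage_size \<mu> N"
  defines "m \<equiv> storage_size \<mu> N"
  shows "measure_pmf.prob (placement_pmf K \<mu> N)
      ({U. n \<in> stored_exactly_by K N U W} \<inter> {U. n' \<in> stored_exactly_by K N U W}) =
    (\<Prod>k\<in>{1..K}. if k \<in> W then real m / real N * (real (m - 1) / real (N - 1))
      else 1 - 2 * (real m / real N) + real m / real N * (real (m - 1) / real (N - 1)))"
proof -
  have "{U. n \<in> stored_exactly_by K N U W} \<inter> {U. n' \<in> stored_exactly_by K N U W} =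
      {U. \<forall>k\<in>{1..K}. U k \<in> {A. (n \<in> A \<longleftrightarrow> k \<in> W) \<and> (n' \<in> A \<longleftrightarrow> k \<in> W)}}"
    using assms by (auto simp: stored_exactly_by_def)
  then show ?thesis
    by (simp only: prob_placement_Pi prob_user_pattern_pair[OF assms(1-5)] m_def)
qed

text \<open>With \<open>a N\<close> the probability for one file and \<open>b N\<close> for two
  distinct files, the second moment is \<open>a N / real N + (1 - 1 / real N) * b N - 2 * p * a N +
  p\<^sup>2\<close>. It vanishes in the limit because \<open>a\<close> tends to \<open>p\<close> and
  \<open>b\<close> to \<open>p\<^sup>2\<close>.\<close>

lemma stored_fraction_second_moment_tendsto_0:
  fixes \<mu> :: real
  assumes \<mu>: "0 < \<mu>" "\<mu> < 1" and W: "W \<subseteq> {1..K}"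
  defines "p \<equiv> \<mu> ^ card W * (1 - \<mu>) ^ (K - card W)"
  shows "(\<lambda>N. measure_pmf.expectation (placement_pmf K \<mu> N)
      (\<lambda>U. (real (card (stored_exactly_by K N U W)) / real N - p)\<^sup>2)) \<longlonglongrightarrow> 0"
proof -
  have p_prod: "p = (\<Prod>k\<in>{1..K}. if k \<in> W then \<mu> else 1 - \<mu>)"
  proof -
    have "finite W" using W by (rule finite_subset) simp
    then have "card ({1..K} - W) = K - card W" using W by (simp add: card_Diff_subset)
    then show ?thesis using W by (simp add: prod.If_cases p_def Int_absorb1 Diff_eq[symmetric])
  qed
  define m where "m = storage_size \<mu>"
  define q where "q N = real (m N) / real N" for N
  \<comment> \<open>For large \<open>N\<close>, a user that stores a given file stores a given
    second file with conditional probability \<open>q' N\<close>. Its limit agrees with that of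
    \<open>q\<close>, which makes the two files asymptotically uncorrelated.\<close>
  define q' where "q' N = real (m N - 1) / real (N - 1)" for N
  define a where "a N = (\<Prod>k\<in>{1..K}. if k \<in> W then q N else 1 - q N)" for N
  define b where "b N = (\<Prod>k\<in>{1..K}. if k \<in> W then q N * q' N else 1 - 2 * q N + q N * q' N)" for N
  have q: "q \<longlonglongrightarrow> \<mu>"
    unfolding q_def m_def by (rule storage_size_ratio_tendsto[OF \<mu>(1)])
  have m_ge: "\<forall>\<^sub>F N in sequentially. 2 \<le> m N"
  proof -
    have "filterlim (\<lambda>N::nat. \<mu> * real N) at_top sequentially" using \<mu> by real_asymp
    then have "\<forall>\<^sub>F N in sequentially. 2 \<le> \<mu> * real N" by (simp add: filterlim_at_top)
    then show ?thesis
      by eventually_elim (auto simp: m_def storage_size_def le_nat_iff le_floor_iff)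
  qed
  have q': "q' \<longlonglongrightarrow> \<mu>"
  proof -
    \<comment> \<open>Numerator and denominator of \<open>q' N\<close> are both divided by
      \<open>real N\<close>.\<close>
    have "(\<lambda>N. (q N - 1 / real N) * (real N / (real N - 1))) \<longlonglongrightarrow> (\<mu> - 0) * 1"
      by (intro tendsto_intros q) real_asymp+
    then have lim: "(\<lambda>N. (q N - 1 / real N) * (real N / (real N - 1))) \<longlonglongrightarrow> \<mu>" by simp
    have "\<forall>\<^sub>F N in sequentially. (q N - 1 / real N) * (real N / (real N - 1)) = q' N"
      using m_ge eventually_gt_at_top[of 1]
      by eventually_elim (auto simp: q_def q'_def field_simps of_nat_diff)
    then show ?thesis using lim by (rule Lim_transform_eventually[rotated])
  qed
  have a: "a \<longlonglongrightarrow> p"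
    unfolding a_def p_prod by (intro tendsto_prod) (auto intro!: tendsto_intros q)
  have b: "b \<longlonglongrightarrow> p\<^sup>2"
    unfolding b_def p_prod power2_eq_square prod.distrib[symmetric]
  proof (intro tendsto_prod)
    fix k
    have "(\<lambda>N. q N * q' N) \<longlonglongrightarrow> \<mu> * \<mu>"
      "(\<lambda>N. 1 - 2 * q N + q N * q' N) \<longlonglongrightarrow> 1 - 2 * \<mu> + \<mu> * \<mu>"
      by (intro tendsto_intros q q')+
    moreover have "1 - 2 * \<mu> + \<mu> * \<mu> = (1 - \<mu>) * (1 - \<mu>)" by (simp add: algebra_simps)
    ultimately show "(\<lambda>N. if k \<in> W then q N * q' N else 1 - 2 * q N + q N * q' N)
        \<longlonglongrightarrow> (if k \<in> W then \<mu> else 1 - \<mu>) * (if k \<in> W then \<mu> else 1 - \<mu>)" by simp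
  qed
  have eq: "\<forall>\<^sub>F N in sequentially. a N / real N + (1 - 1 / real N) * b N - 2 * p * a N + p\<^sup>2 =
      measure_pmf.expectation (placement_pmf K \<mu> N)
        (\<lambda>U. (real (card (stored_exactly_by K N U W)) / real N - p)\<^sup>2)"
    using m_ge eventually_gt_at_top[of 0]
  proof eventually_elim
    case (elim N)
    let ?M = "placement_pmf K \<mu> N" and ?E = "\<lambda>n. {U. n \<in> stored_exactly_by K N U W}"
    have m1: "1 \<le> storage_size \<mu> N" and m2: "2 \<le> storage_size \<mu> N" using elim by (auto simp: m_def)
    have single: "measure_pmf.prob ?M (?E n) = a N" if "n \<in> {1..N}" for n
      using prob_stored_exactly_by[OF \<mu>(2) that m1, where W = W]
      by (simp only: a_def q_def m_def)
    have pair: "measure_pmf.prob ?M (?E n \<inter> ?E n') = b N"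
      if "n \<in> {1..N}" "n' \<in> {1..N}" "n \<noteq> n'" for n n'
      using prob_stored_exactly_by_pair[OF \<mu>(2) that m2, where W = W]
      by (simp only: b_def q_def q'_def m_def)
    \<comment> \<open>On the diagonal the two events coincide and the single-file probability
      \<open>a N\<close> appears; each of the other \<open>N - 1\<close> terms equals
      \<open>b N\<close>.\<close>
    have row: "(\<Sum>n'\<in>{1..N}. measure_pmf.prob ?M (?E n \<inter> ?E n')) = a N + (real N - 1) * b N"
      if n: "n \<in> {1..N}" for n
    proof -
      have "(\<Sum>n'\<in>{1..N}. measure_pmf.prob ?M (?E n \<inter> ?E n')) =
          measure_pmf.prob ?M (?E n \<inter> ?E n) + (\<Sum>n'\<in>{1..N} - {n}. measure_pmf.prob ?M (?E n \<inter> ?E n'))"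
        using n by (intro sum.remove) auto
      also have "(\<Sum>n'\<in>{1..N} - {n}. measure_pmf.prob ?M (?E n \<inter> ?E n')) = (\<Sum>n'\<in>{1..N} - {n}. b N)"
        using n by (intro sum.cong refl pair) auto
      finally show ?thesis using n single[OF n] by (simp add: of_nat_diff)
    qed
    have "{n \<in> {1..N}. U \<in> ?E n} = stored_exactly_by K N U W" for U
      by (auto simp: stored_exactly_by_def)
    then have "measure_pmf.expectation ?M (\<lambda>U. (real (card (stored_exactly_by K N U W)) / real N - p)\<^sup>2) =
        (\<Sum>n\<in>{1..N}. \<Sum>n'\<in>{1..N}. measure_pmf.prob ?M (?E n \<inter> ?E n')) / (real N)\<^sup>2
        - 2 * p * (\<Sum>n\<in>{1..N}. measure_pmf.prob ?M (?E n)) / real N + p\<^sup>2"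
      using count_second_moment[OF finite_set_placement_pmf[OF \<mu>(2)], of "{1..N}" K N ?E "real N" "p"]
      by simp
    also have "(\<Sum>n\<in>{1..N}. \<Sum>n'\<in>{1..N}. measure_pmf.prob ?M (?E n \<inter> ?E n')) =
        real N * (a N + (real N - 1) * b N)"
      by (subst sum.cong[OF refl row]) auto
    also have "(\<Sum>n\<in>{1..N}. measure_pmf.prob ?M (?E n)) = real N * a N"
      by (subst sum.cong[OF refl single]) auto
    also have "(real N * (a N + (real N - 1) * b N)) / (real N)\<^sup>2
        - 2 * p * (real N * a N) / real N + p\<^sup>2 =
        a N / real N + (1 - 1 / real N) * b N - 2 * p * a N + p\<^sup>2"
      using elim by (simp add: power2_eq_square field_simps)
    finally show ?case by simp
  qed
  have "(\<lambda>N. a N * (1 / real N) + (1 - 1 / real N) * b N - 2 * p * a N + p\<^sup>2)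
      \<longlonglongrightarrow> p * 0 + (1 - 0) * p\<^sup>2 - 2 * p * p + p\<^sup>2"
    by (intro tendsto_intros a b)
  then have "(\<lambda>N. a N / real N + (1 - 1 / real N) * b N - 2 * p * a N + p\<^sup>2) \<longlonglongrightarrow> 0"
    by (simp add: power2_eq_square)
  then show ?thesis using eq by (rule Lim_transform_eventually)
qed

text \<open>Markov's inequality for the squared deviation bounds the failure for one
  \<open>W\<close>. The union bound runs over the subsets of \<open>{1..K}\<close>, whose number
  does not grow with \<open>N\<close>.\<close>

lemma prob_stored_fractions_tendsto_1:
  fixes K :: nat
  assumes \<mu>: "0 < \<mu>" "\<mu> < 1" and \<delta>: "0 < \<delta>"
  defines "p \<equiv> \<lambda>W::nat set. \<mu> ^ card W * (1 - \<mu>) ^ (K - card W)"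
  shows "(\<lambda>N. measure_pmf.prob (placement_pmf K \<mu> N)
      {U. \<forall>W\<in>Pow {1..K}. \<bar>real (card (stored_exactly_by K N U W)) / real N - p W\<bar> \<le> \<delta>}) \<longlonglongrightarrow> 1"
    (is "(\<lambda>N. measure_pmf.prob (?M N) (?G N)) \<longlonglongrightarrow> 1")
proof -
  define Y where "Y N W U = (real (card (stored_exactly_by K N U W)) / real N - p W)\<^sup>2" for N W U
  define e where "e N W = measure_pmf.expectation (?M N) (Y N W)" for N W
  have lower: "1 - (\<Sum>W\<in>Pow {1..K}. e N W / \<delta>\<^sup>2) \<le> measure_pmf.prob (?M N) (?G N)" for N
  proof -
    have markov: "measure_pmf.prob (?M N) {U. \<delta>\<^sup>2 \<le> Y N W U} \<le> e N W / \<delta>\<^sup>2" for W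
      using integral_Markov_inequality_measure[of "?M N" "Y N W" UNIV "\<delta>\<^sup>2"] \<delta>
        integrable_measure_pmf_finite[OF finite_set_placement_pmf[OF \<mu>(2)], where f = "Y N W"]
      unfolding e_def by (simp add: Y_def[abs_def])
    have "- ?G N \<subseteq> (\<Union>W\<in>Pow {1..K}. {U. \<delta>\<^sup>2 \<le> Y N W U})"
    proof
      fix U assume "U \<in> - ?G N"
      then obtain W where "W \<in> Pow {1..K}"
        "\<delta> \<le> \<bar>real (card (stored_exactly_by K N U W)) / real N - p W\<bar>"
        by (auto simp: not_le intro: less_imp_le)
      then have "\<delta>\<^sup>2 \<le> Y N W U" unfolding Y_def
        using \<delta> by (metis abs_le_square_iff abs_of_pos)
      then show "U \<in> (\<Union>W\<in>Pow {1..K}. {U. \<delta>\<^sup>2 \<le> Y N W U})" using \<open>W \<in> Pow {1..K}\<close> by blast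
    qed
    then have "measure_pmf.prob (?M N) (- ?G N) \<le>
        measure_pmf.prob (?M N) (\<Union>W\<in>Pow {1..K}. {U. \<delta>\<^sup>2 \<le> Y N W U})"
      by (intro measure_pmf.finite_measure_mono) auto
    also have "\<dots> \<le> (\<Sum>W\<in>Pow {1..K}. measure_pmf.prob (?M N) {U. \<delta>\<^sup>2 \<le> Y N W U})"
      by (intro measure_pmf.finite_measure_subadditive_finite) auto
    also have "\<dots> \<le> (\<Sum>W\<in>Pow {1..K}. e N W / \<delta>\<^sup>2)" by (intro sum_mono markov)
    finally show ?thesis
      using measure_pmf.prob_compl[of "?G N" "?M N"] by (simp add: Compl_eq_Diff_UNIV)
  qed
  have "(\<lambda>N. 1 - (\<Sum>W\<in>Pow {1..K}. e N W / \<delta>\<^sup>2)) \<longlonglongrightarrow> 1 - (\<Sum>W\<in>Pow {1..K}. 0 / \<delta>\<^sup>2)"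
    unfolding e_def Y_def p_def
    using \<delta> by (intro tendsto_intros stored_fraction_second_moment_tendsto_0 \<mu>) auto
  then have "(\<lambda>N. 1 - (\<Sum>W\<in>Pow {1..K}. e N W / \<delta>\<^sup>2)) \<longlonglongrightarrow> 1" by simp
  then show ?thesis
    by (rule tendsto_sandwich[rotated 2, OF _ tendsto_const]) (use lower in auto)
qed

section \<open>Random linear combinations\<close>

text \<open>Invertibility of every square coefficient matrix that remains when the column of one
  user \<open>k\<close> is deleted. It is stated as a trivial kernel rather than by determinants,
  since both the union bound and the decoding argue with kernel vectors.\<close>

definition decodable_coefficients :: "nat \<Rightarrow> 'f ring \<Rightarrow> (nat set \<times> nat \<times> nat \<Rightarrow> 'f) \<Rightarrow> bool" where
  "decodable_coefficients K F c \<longleftrightarrow>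
     (\<forall>S\<in>groups K. \<forall>k\<in>S. \<forall>y. y \<in> S - {k} \<rightarrow> carrier F \<longrightarrow>
        (\<forall>j<card S - 1. (\<Oplus>\<^bsub>F\<^esub>i\<in>S - {k}. c (S, j, i) \<otimes>\<^bsub>F\<^esub> y i) = \<zero>\<^bsub>F\<^esub>) \<longrightarrow>
        (\<forall>i\<in>S - {k}. y i = \<zero>\<^bsub>F\<^esub>))"

lemma finite_groups [simp]: "finite (groups K)"
  unfolding groups_def by simp

lemma groups_finite: "S \<in> groups K \<Longrightarrow> finite S"
  unfolding groups_def by (auto intro: finite_subset)

lemma finite_coefficient_indices [simp]: "finite (coefficient_indices K)"
proof (rule finite_subset)
  show "coefficient_indices K \<subseteq> (SIGMA S:groups K. {..<card S - 1} \<times> S)"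
    by (auto simp: coefficient_indices_def)
qed (auto simp: groups_finite)

text \<open>The support of \<open>coefficients_pmf\<close>. The default value zero lies in the
  carrier too, so every value of such a function is a field element, also outside the index
  set.\<close>

definition coefficient_functions :: "nat \<Rightarrow> 'f ring \<Rightarrow> (nat set \<times> nat \<times> nat \<Rightarrow> 'f) set" where
  "coefficient_functions K F = PiE_dflt (coefficient_indices K) \<zero>\<^bsub>F\<^esub> (\<lambda>_. carrier F)"

lemma coefficient_functions_finite:
  fixes R :: "'f ring" (structure)
  assumes "field R" "finite (carrier R)"
  shows "finite (coefficient_functions K R)"
    and "card (coefficient_functions K R) = card (carrier R) ^ card (coefficient_indices K)"
    and "coefficient_functions K R \<noteq> {}"
    and "coefficients_pmf K R = pmf_of_set (coefficient_functions K R)"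
proof -
  interpret field R by fact
  show "finite (coefficient_functions K R)"
    "card (coefficient_functions K R) = card (carrier R) ^ card (coefficient_indices K)"
    "coefficient_functions K R \<noteq> {}"
    using assms(2) zero_closed
    by (auto simp: coefficient_functions_def coefficients_pmf_def card_PiE_dflt
        intro!: finite_PiE_dflt)
  show "coefficients_pmf K R = pmf_of_set (coefficient_functions K R)"
    unfolding coefficient_functions_def coefficients_pmf_def
    using assms(2) zero_closed by (intro Pi_pmf_of_set) auto
qed

lemma coefficient_functions_closed:
  fixes R :: "'f ring" (structure)
  assumes "field R" "c \<in> coefficient_functions K R"
  shows "c x \<in> carrier R"
proof -
  interpret field R by fact
  show ?thesis
    using assms(2) unfolding coefficient_functions_def PiE_dflt_def
    by (cases "x \<in> coefficient_indices K") (auto simp del: split_paired_All)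
qed

text \<open>Since \<open>y i0\<close> is a unit, the linear equations determine the entries of \<open>c\<close> at \<open>i0\<close> from the others.\<close>

lemma prob_kernel_vector_le:
  fixes R :: "'f ring" (structure)
  assumes R: "field R" and fin: "finite (carrier R)" and S: "S \<in> groups K" and I: "I \<subseteq> S" "i0 \<in> I"
    and y: "y \<in> I \<rightarrow> carrier R" "y i0 = \<one>"
  shows "measure_pmf.prob (coefficients_pmf K R)
      {c. \<forall>j<card S - 1. (\<Oplus>i\<in>I. c (S, j, i) \<otimes> y i) = \<zero>}
    \<le> 1 / real (card (carrier R)) ^ (card S - 1)"
proof -
  interpret field R by fact
  let ?Ind = "coefficient_indices K" and ?q = "card (carrier R)" and ?m = "card S - 1"
  \<comment> \<open>The coefficients in column \<open>i0\<close>, one for each of the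
    \<open>card S - 1\<close> equations.\<close>
  define P where "P = (\<lambda>j. (S, j, i0)) ` {..<?m}"
  define B where "B = coefficient_functions K R \<inter> {c. \<forall>j<?m. (\<Oplus>i\<in>I. c (S, j, i) \<otimes> y i) = \<zero>}"
  have finI: "finite I" using I(1) groups_finite[OF S] finite_subset by blast
  have P: "P \<subseteq> ?Ind" "card P = ?m" "finite P"
    using S I by (auto simp: P_def coefficient_indices_def card_image inj_on_def)
  have split: "(\<Oplus>i\<in>I. c (S, j, i) \<otimes> y i) =
      c (S, j, i0) \<oplus> (\<Oplus>i\<in>I - {i0}. c (S, j, i) \<otimes> y i)"
    if c: "c \<in> coefficient_functions K R" for c j
  proof -
    note cl = coefficient_functions_closed[OF R c]
    have "(\<Oplus>i\<in>insert i0 (I - {i0}). c (S, j, i) \<otimes> y i) =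
        c (S, j, i0) \<otimes> y i0 \<oplus> (\<Oplus>i\<in>I - {i0}. c (S, j, i) \<otimes> y i)"
      using finI I y cl by (intro finsum_insert) auto
    then show ?thesis using I y cl by (simp add: insert_absorb)
  qed
  \<comment> \<open>A function in \<open>B\<close> is zero outside \<open>?Ind\<close> and is fixed
    on \<open>P\<close> by the equations, so its restriction to \<open>?Ind - P\<close> determines
    it. This removes the factor \<open>?q ^ ?m\<close> from the count.\<close>
  have "inj_on (\<lambda>c. restrict c (?Ind - P)) B"
  proof (rule inj_onI, rule ext)
    fix c c' x
    assume c: "c \<in> B" and c': "c' \<in> B" and eq: "restrict c (?Ind - P) = restrict c' (?Ind - P)"
    have same: "c z = c' z" if "z \<in> ?Ind - P" for z
      using fun_cong[OF eq, of z] that by simp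
    note cl = coefficient_functions_closed[OF R, of c K] coefficient_functions_closed[OF R, of c' K]
    have B: "c \<in> coefficient_functions K R" "c' \<in> coefficient_functions K R"
      using c c' by (auto simp: B_def)
    show "c x = c' x"
    proof (cases "x \<in> P")
      case True
      then obtain j where j: "j < ?m" "x = (S, j, i0)" by (auto simp: P_def)
      have rest: "(\<Oplus>i\<in>I - {i0}. c (S, j, i) \<otimes> y i) = (\<Oplus>i\<in>I - {i0}. c' (S, j, i) \<otimes> y i)"
      proof (rule finsum_cong')
        fix i assume "i \<in> I - {i0}"
        then have "(S, j, i) \<in> ?Ind - P"
          using j S I by (auto simp: P_def coefficient_indices_def)
        then show "c (S, j, i) \<otimes> y i = c' (S, j, i) \<otimes> y i" using same by simp
      qed (use y cl B in auto)
      have cr: "(\<Oplus>i\<in>I - {i0}. c' (S, j, i) \<otimes> y i) \<in> carrier R"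
        using y cl B by (intro finsum_closed) auto
      have "c (S, j, i0) \<oplus> (\<Oplus>i\<in>I - {i0}. c' (S, j, i) \<otimes> y i) = \<zero>"
        "c' (S, j, i0) \<oplus> (\<Oplus>i\<in>I - {i0}. c' (S, j, i) \<otimes> y i) = \<zero>"
        using c c' j split[OF B(1), of j] split[OF B(2), of j] rest by (auto simp: B_def)
      then have "c (S, j, i0) = c' (S, j, i0)"
        using add.right_cancel[OF cr cl(1)[OF B(1), of "(S, j, i0)"] cl(2)[OF B(2), of "(S, j, i0)"]]
        by simp
      then show ?thesis by (simp add: j)
    next
      case False
      show ?thesis
      proof (cases "x \<in> ?Ind")
        case True then show ?thesis using False same by auto
      next
        case False
        then show ?thesis using B by (simp add: coefficient_functions_def PiE_dflt_def del: split_paired_All)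
      qed
    qed
  qed
  moreover have "(\<lambda>c. restrict c (?Ind - P)) ` B \<subseteq> (?Ind - P) \<rightarrow>\<^sub>E carrier R"
  proof (intro image_subsetI iffD2[OF restrict_PiE_iff] ballI)
    fix c x assume "c \<in> B"
    then show "c x \<in> carrier R" using coefficient_functions_closed[OF R, of c K] by (simp add: B_def)
  qed
  ultimately have "card B \<le> card ((?Ind - P) \<rightarrow>\<^sub>E carrier R)"
    using fin by (intro card_inj_on_le) (simp_all add: finite_PiE)
  also have "\<dots> = ?q ^ (card ?Ind - ?m)"
    using P by (simp add: card_PiE card_Diff_subset)
  finally have card_B: "real (card B) \<le> real ?q ^ (card ?Ind - ?m)"
    by (metis of_nat_le_iff of_nat_power)
  have q: "0 < real ?q" using fin zero_closed by (auto simp: card_gt_0_iff)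
  have m: "?m \<le> card ?Ind" using P card_mono[OF finite_coefficient_indices P(1)] by simp
  have "measure_pmf.prob (coefficients_pmf K R)
      {c. \<forall>j<?m. (\<Oplus>i\<in>I. c (S, j, i) \<otimes> y i) = \<zero>} = real (card B) / real ?q ^ card ?Ind"
    using coefficient_functions_finite[OF R fin, of K] by (simp add: measure_pmf_of_set B_def)
  also have "\<dots> \<le> real ?q ^ (card ?Ind - ?m) / real ?q ^ card ?Ind"
    using card_B by (intro divide_right_mono) auto
  also have "\<dots> = 1 / real ?q ^ ?m" using q m by (simp add: power_diff)
  finally show ?thesis .
qed

text \<open>A nonzero kernel vector can be scaled to have an entry \<open>\<one>\<close>; the union bound runs over the
  position of this entry and over the other entries.\<close>

lemma prob_decodable_ge:
  fixes R :: "'f ring" (structure)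
  assumes R: "field R" and fin: "finite (carrier R)"
  shows "1 - (\<Sum>S\<in>groups K. \<Sum>k\<in>S. real (card S - 1)) / real (card (carrier R))
    \<le> measure_pmf.prob (coefficients_pmf K R)
        ({c. decodable_coefficients K R c} \<inter> coefficient_functions K R)"
proof -
  interpret field R by fact
  let ?M = "coefficients_pmf K R" and ?q = "card (carrier R)"
  \<comment> \<open>The entry at \<open>i0\<close> is normalised to \<open>\<one>\<close>, so
    \<open>y\<close> ranges over the remaining \<open>card S - 2\<close> entries only.\<close>
  define D where "D S k i0 y = {c. \<forall>j<card S - 1. (\<Oplus>i\<in>S - {k}. c (S, j, i) \<otimes> (if i = i0 then \<one> else y i)) = \<zero>}"
    for S :: "nat set" and k i0 :: nat and y
  define Y where "Y S k i0 = (S - {k} - {i0}) \<rightarrow>\<^sub>E carrier R" for S :: "nat set" and k i0 :: nat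
  have q: "0 < real ?q" using fin zero_closed by (auto simp: card_gt_0_iff)
  \<comment> \<open>Intersecting with the support leaves the probability unchanged and makes every
    \<open>c\<close> a coefficient function, so that its values lie in the carrier.\<close>
  have bad: "- ({c. decodable_coefficients K R c} \<inter> coefficient_functions K R) \<inter> set_pmf ?M \<subseteq>
      (\<Union>S\<in>groups K. \<Union>k\<in>S. \<Union>i0\<in>S - {k}. \<Union>y\<in>Y S k i0. D S k i0 y)"
  proof
    fix c assume c: "c \<in> - ({c. decodable_coefficients K R c} \<inter> coefficient_functions K R) \<inter> set_pmf ?M"
    then have cf: "c \<in> coefficient_functions K R"
      using coefficient_functions_finite[OF R fin, of K] by simp
    then have "\<not> decodable_coefficients K R c" using c by simp
    then obtain S k y i0 where S: "S \<in> groups K" "k \<in> S" and y: "y \<in> S - {k} \<rightarrow> carrier R"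
      and ker: "\<And>j. j < card S - 1 \<Longrightarrow> (\<Oplus>i\<in>S - {k}. c (S, j, i) \<otimes> y i) = \<zero>"
      and i0: "i0 \<in> S - {k}" "y i0 \<noteq> \<zero>"
      unfolding decodable_coefficients_def by blast
    \<comment> \<open>Multiplying a kernel vector by the inverse of its nonzero entry at
      \<open>i0\<close> keeps it in the kernel and produces the normalised form.\<close>
    have u: "y i0 \<in> Units R" using i0 y by (auto simp: field_Units)
    let ?u = "inv (y i0)"
    have u_cl: "?u \<in> carrier R" using u by simp
    define z where "z = restrict (\<lambda>i. y i \<otimes> ?u) (S - {k} - {i0})"
    have "(\<Oplus>i\<in>S - {k}. c (S, j, i) \<otimes> (if i = i0 then \<one> else z i)) = \<zero>"
      if j: "j < card S - 1" for j
    proof -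
      have "(\<Oplus>i\<in>S - {k}. c (S, j, i) \<otimes> (if i = i0 then \<one> else z i)) =
          (\<Oplus>i\<in>S - {k}. (c (S, j, i) \<otimes> y i) \<otimes> ?u)"
      proof (rule finsum_cong')
        fix i assume i: "i \<in> S - {k}"
        then have yi: "y i \<in> carrier R" using y by auto
        show "c (S, j, i) \<otimes> (if i = i0 then \<one> else z i) = (c (S, j, i) \<otimes> y i) \<otimes> ?u"
          using i u u_cl yi coefficient_functions_closed[OF R cf]
          by (auto simp: z_def m_assoc)
      qed (use y u_cl coefficient_functions_closed[OF R cf] in \<open>auto simp: Pi_iff\<close>)
      also have "\<dots> = (\<Oplus>i\<in>S - {k}. c (S, j, i) \<otimes> y i) \<otimes> ?u"
        using y u_cl coefficient_functions_closed[OF R cf] groups_finite[OF S(1)]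
        by (intro finsum_ldistr[symmetric]) auto
      finally show ?thesis using ker[OF j] u_cl by simp
    qed
    then have "c \<in> D S k i0 z" by (simp add: D_def)
    moreover have "z \<in> Y S k i0" unfolding Y_def z_def using y u_cl by (subst restrict_PiE_iff) auto
    ultimately show "c \<in> (\<Union>S\<in>groups K. \<Union>k\<in>S. \<Union>i0\<in>S - {k}. \<Union>y\<in>Y S k i0. D S k i0 y)"
      using S i0 by blast
  qed
  have D_le: "measure_pmf.prob ?M (\<Union>y\<in>Y S k i0. D S k i0 y) \<le> 1 / real ?q"
    if S: "S \<in> groups K" "k \<in> S" "i0 \<in> S - {k}" for S k i0
  proof -
    have fS: "finite S" and cS: "card S \<ge> 2"
      using groups_finite[OF S(1)] S(1) by (simp_all add: groups_def)
    have fY: "finite (Y S k i0)" using fS fin by (simp add: Y_def finite_PiE)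
    have cY: "card (Y S k i0) = ?q ^ (card S - 2)"
      using fS S by (simp add: Y_def card_PiE numeral_2_eq_2)
    have "measure_pmf.prob ?M (\<Union>y\<in>Y S k i0. D S k i0 y) \<le>
        (\<Sum>y\<in>Y S k i0. measure_pmf.prob ?M (D S k i0 y))"
      using fY by (intro measure_UNION_le) auto
    also have "\<dots> \<le> (\<Sum>y\<in>Y S k i0. 1 / real ?q ^ (card S - 1))"
    proof (rule sum_mono)
      fix y assume "y \<in> Y S k i0"
      then have "(\<lambda>i. if i = i0 then \<one> else y i) \<in> S - {k} \<rightarrow> carrier R"
        by (auto simp: Y_def PiE_def Pi_def)
      then show "measure_pmf.prob ?M (D S k i0 y) \<le> 1 / real ?q ^ (card S - 1)"
        unfolding D_def using S
        by (intro prob_kernel_vector_le[OF R fin S(1), of "S - {k}" i0]) simp_all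
    qed
    \<comment> \<open>There are \<open>?q ^ (card S - 2)\<close> normalised vectors, each with
      probability at most \<open>1 / ?q ^ (card S - 1)\<close>; exactly one factor
      \<open>1 / ?q\<close> survives.\<close>
    also have "\<dots> = real ?q ^ (card S - 2) / real ?q ^ Suc (card S - 2)"
    proof -
      have "card S - 1 = Suc (card S - 2)" using cS by simp
      then show ?thesis by (simp add: cY)
    qed
    also have "\<dots> = 1 / real ?q" using q by simp
    finally show ?thesis .
  qed
  have "measure_pmf.prob ?M (- ({c. decodable_coefficients K R c} \<inter> coefficient_functions K R)) =
      measure_pmf.prob ?M (- ({c. decodable_coefficients K R c} \<inter> coefficient_functions K R) \<inter> set_pmf ?M)"
    by (simp add: measure_Int_set_pmf)
  also have "\<dots> \<le> measure_pmf.prob ?M (\<Union>S\<in>groups K. \<Union>k\<in>S. \<Union>i0\<in>S - {k}. \<Union>y\<in>Y S k i0. D S k i0 y)"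
    by (intro measure_pmf.finite_measure_mono bad) simp
  also have "\<dots> \<le> (\<Sum>S\<in>groups K. \<Sum>k\<in>S. \<Sum>i0\<in>S - {k}. measure_pmf.prob ?M (\<Union>y\<in>Y S k i0. D S k i0 y))"
  proof -
    have "measure_pmf.prob ?M (\<Union>i0\<in>S - {k}. \<Union>y\<in>Y S k i0. D S k i0 y) \<le>
        (\<Sum>i0\<in>S - {k}. measure_pmf.prob ?M (\<Union>y\<in>Y S k i0. D S k i0 y))"
      if "S \<in> groups K" for S k
      using groups_finite[OF that] by (intro measure_UNION_le) auto
    then have "measure_pmf.prob ?M (\<Union>k\<in>S. \<Union>i0\<in>S - {k}. \<Union>y\<in>Y S k i0. D S k i0 y) \<le>
        (\<Sum>k\<in>S. \<Sum>i0\<in>S - {k}. measure_pmf.prob ?M (\<Union>y\<in>Y S k i0. D S k i0 y))"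
      if "S \<in> groups K" for S
      using that by (intro order_trans[OF measure_UNION_le[OF groups_finite[OF that]]] sum_mono) simp_all
    then show ?thesis by (intro order_trans[OF measure_UNION_le[OF finite_groups]] sum_mono) simp_all
  qed
  also have "\<dots> \<le> (\<Sum>S\<in>groups K. \<Sum>k\<in>S. \<Sum>i0\<in>S - {k}. 1 / real ?q)"
    by (intro sum_mono D_le) auto
  also have "\<dots> = (\<Sum>S\<in>groups K. \<Sum>k\<in>S. real (card S - 1)) / real ?q"
    unfolding sum_divide_distrib by (intro sum.cong refl) (auto simp: groups_finite)
  finally show ?thesis
    using measure_pmf.prob_compl[of "{c. decodable_coefficients K R c} \<inter> coefficient_functions K R" ?M]
    by (simp add: Compl_eq_Diff_UNIV)
qed

lemma field_labelling_card_carrier: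
  assumes "field_labelling r F lab"
  shows "card (carrier F) = 2 ^ r" and "finite (carrier F)"
proof -
  have bij: "bij_betw lab {b. length b = r} (carrier F)" using assms by (simp add: field_labelling_def)
  show "card (carrier F) = 2 ^ r"
    using bij_betw_same_card[OF bij] card_lists_length_eq[of "UNIV::bool set" r] by simp
  show "finite (carrier F)"
    using bij_betw_finite[OF bij] finite_lists_length_eq[of "UNIV::bool set" r] by simp
qed

text \<open>The number of triples \<open>(S, k, i0)\<close> in the union bound depends on
  \<open>K\<close> only, while the field has \<open>2 ^ r N\<close> elements; the failure bound
  therefore tends to 0.\<close>

lemma prob_decodable_tendsto_1:
  assumes field: "\<And>N. field_labelling (r N) (F N) (lab N)"
    and field_size: "filterlim r at_top sequentially"
  shows "(\<lambda>N. measure_pmf.prob (coefficients_pmf K (F N))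
      ({c. decodable_coefficients K (F N) c} \<inter> coefficient_functions K (F N))) \<longlonglongrightarrow> 1"
proof -
  define C where "C = (\<Sum>S\<in>groups K. \<Sum>k\<in>S. real (card S - 1))"
  have "(\<lambda>n::nat. 1 - C / 2 ^ n) \<longlonglongrightarrow> 1" by real_asymp
  then have lim: "(\<lambda>N. 1 - C / 2 ^ r N) \<longlonglongrightarrow> 1" using field_size by (rule filterlim_compose)
  show ?thesis
  proof (rule tendsto_sandwich[OF _ _ lim tendsto_const])
    show "\<forall>\<^sub>F N in sequentially. 1 - C / 2 ^ r N \<le> measure_pmf.prob (coefficients_pmf K (F N))
        ({c. decodable_coefficients K (F N) c} \<inter> coefficient_functions K (F N))"
    proof (intro always_eventually allI)
      fix N
      interpret field "F N" using field[of N] by (simp add: field_labelling_def)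
      show "1 - C / 2 ^ r N \<le> measure_pmf.prob (coefficients_pmf K (F N))
        ({c. decodable_coefficients K (F N) c} \<inter> coefficient_functions K (F N))"
        using prob_decodable_ge[OF field_axioms, of K] field_labelling_card_carrier[OF field[of N]]
        by (simp add: C_def)
    qed
  qed simp
qed

section \<open>Decoding\<close>

lemma length_zero_pad [simp]: "length (zero_pad L x) = max L (length x)"
  by (simp add: zero_pad_def)

lemma nth_zero_pad: "t < length x \<Longrightarrow> zero_pad L x ! t = x ! t"
  by (simp add: zero_pad_def nth_append)

lemma length_padded_xor [simp]: "length (padded_xor I x) = max_length I x"
  by (simp add: padded_xor_def)

lemma max_length_cong:
  "(\<And>i. i \<in> I \<Longrightarrow> length (x i) = length (y i)) \<Longrightarrow> max_length I x = max_length I y"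
  unfolding max_length_def by (metis (no_types, lifting) image_cong)

lemma length_le_max_length: "finite I \<Longrightarrow> i \<in> I \<Longrightarrow> length (x i) \<le> max_length I x"
  unfolding max_length_def by simp

lemma padded_xor_cong:
  assumes "\<And>i. i \<in> I \<Longrightarrow> x i = y i"
  shows "padded_xor I x = padded_xor I y"
proof -
  have m: "max_length I x = max_length I y" using assms by (intro max_length_cong) simp
  have "{i \<in> I. zero_pad L (x i) ! t} = {i \<in> I. zero_pad L (y i) ! t}" for L t
    using assms by auto
  then show ?thesis by (simp add: padded_xor_def m)
qed

text \<open>At each position the strings other than the one at \<open>k\<close> contribute the same
  number of ones to both XORs, so equal parities force equal bits at \<open>k\<close>. Since all
  lengths agree, both sides are padded to the same length.\<close>

lemma padded_xor_cancel:
  assumes fin: "finite I" and k: "k \<in> I"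
    and eq: "padded_xor I x = padded_xor I y"
    and others: "\<And>i. i \<in> I - {k} \<Longrightarrow> x i = y i"
    and len: "length (x k) = length (y k)"
  shows "x k = y k"
proof (rule nth_equalityI[OF len])
  fix t assume t: "t < length (x k)"
  define L where "L = max_length I x"
  have L: "max_length I y = L"
    unfolding L_def using others len by (intro max_length_cong) (metis DiffI singletonD)
  have tL: "t < L" using t length_le_max_length[OF fin k, of x] by (simp add: L_def)
  have split: "card {i \<in> I. zero_pad L (z i) ! t} =
      of_bool (z k ! t) + card {i \<in> I - {k}. zero_pad L (z i) ! t}"
    if "t < length (z k)" for z
  proof -
    have "{i \<in> I. zero_pad L (z i) ! t} =
        (if z k ! t then insert k {i \<in> I - {k}. zero_pad L (z i) ! t}
         else {i \<in> I - {k}. zero_pad L (z i) ! t})"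
      using k that by (auto simp: nth_zero_pad)
    then show ?thesis using fin by simp
  qed
  have "{i \<in> I - {k}. zero_pad L (x i) ! t} = {i \<in> I - {k}. zero_pad L (y i) ! t}"
    using others by auto
  moreover have "odd (card {i \<in> I. zero_pad L (x i) ! t}) = odd (card {i \<in> I. zero_pad L (y i) ! t})"
    using arg_cong[OF eq, of "\<lambda>b. b ! t"] tL by (simp add: padded_xor_def L L_def[symmetric])
  ultimately show "x k ! t = y k ! t"
    using split[of x, OF t] split[of y, OF t[unfolded len]]
    by (cases "x k ! t"; cases "y k ! t") simp_all
qed

lemma length_concat_map_const:
  assumes "\<And>x. x \<in> set xs \<Longrightarrow> length (f x) = l"
  shows "length (concat (map f xs)) = length xs * l"
  using assms by (induction xs) auto

text \<open>A concatenation can be cut into its pieces again once the lengths of the pieces are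
  known.\<close>

lemma concat_map_cancel:
  assumes "concat (map f xs) = concat (map g xs)"
    and "\<And>x. x \<in> set xs \<Longrightarrow> length (f x) = length (g x)" and "x \<in> set xs"
  shows "f x = g x"
proof -
  have "map f xs = map g xs"
    using assms(1,2) by (intro concat_injective) (auto simp: zip_map_map zip_same_conv_map)
  then show ?thesis using assms(3) by simp
qed

text \<open>Rounding up to whole blocks costs at most \<open>r\<close> bits; this is the source of
  the term \<open>real r / real N\<close> in the downlink error.\<close>

lemma le_num_blocks_times:
  assumes "0 < r"
  shows "L \<le> num_blocks r L * r" and "num_blocks r L * r \<le> L + r"
proof -
  have ceil: "real (num_blocks r L) = of_int \<lceil>real L / real r\<rceil>"
    by (simp add: num_blocks_def)
  have "real L / real r \<le> real (num_blocks r L)" "real (num_blocks r L) \<le> real L / real r + 1"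
    unfolding ceil by linarith+
  then have "real L \<le> real (num_blocks r L * r)" "real (num_blocks r L * r) \<le> real (L + r)"
    using assms by (simp_all add: field_simps)
  then show "L \<le> num_blocks r L * r" "num_blocks r L * r \<le> L + r"
    unfolding of_nat_le_iff by simp_all
qed

lemma length_block:
  assumes "p < num_blocks r L"
  shows "length (block r L x p) = r"
proof -
  have "Suc p * r \<le> num_blocks r L * r" using assms by (intro mult_right_mono) auto
  then show ?thesis by (simp add: block_def)
qed

text \<open>Bit \<open>t\<close> of the padded string sits in block \<open>t div r\<close> at offset
  \<open>t mod r\<close>.\<close>

lemma blocks_cancel:
  assumes r: "0 < r" and len: "length x = length y" "length x \<le> L"
    and eq: "\<And>p. p < num_blocks r L \<Longrightarrow> block r L x p = block r L y p"
  shows "x = y"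
proof (rule nth_equalityI[OF len(1)])
  fix t assume t: "t < length x"
  let ?p = "t div r" and ?s = "t mod r" and ?n = "num_blocks r L"
  have "t < ?n * r" using t len le_num_blocks_times(1)[OF r, of L] by linarith
  then have p: "?p < ?n" using r by (simp add: less_mult_imp_div_less)
  have "Suc ?p * r \<le> ?n * r" using p by (intro mult_right_mono) auto
  then have "block r L z ?p ! ?s = zero_pad (?n * r) z ! t" for z
    using r by (simp add: block_def nth_append)
  then have "zero_pad (?n * r) x ! t = zero_pad (?n * r) y ! t" using eq[OF p] by metis
  then show "x ! t = y ! t" using t len by (simp add: nth_zero_pad)
qed

section \<open>Inverting the linear combinations\<close>

lemma field_labelling_pos:
  assumes "field_labelling r F lab"
  shows "0 < r"
proof (rule ccontr)
  interpret field F using assms by (simp add: field_labelling_def)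
  assume "\<not> 0 < r"
  \<comment> \<open>For \<open>r = 0\<close> the empty string would be the only label, while zero
    and one are distinct in a field.\<close>
  then have "card (carrier F) = 1" using field_labelling_card_carrier[OF assms] by simp
  then show False using zero_closed one_closed zero_not_one card_1_singletonE by (metis singletonD)
qed

text \<open>Equal lengths of the inputs give a common number of blocks. Each transmitted label has
  \<open>r\<close> bits, so the strings can be cut into labels, and the inverse labelling is
  injective on the carrier.\<close>

lemma linear_combination_cancel:
  assumes lab: "field_labelling r F lab"
    and eq: "linear_combination r F lab S c x = linear_combination r F lab S c y"
    and len: "\<And>i. i \<in> S \<Longrightarrow> length (x i) = length (y i)"
    and c: "\<And>i. c i \<in> carrier F"
    and p: "p < num_blocks r (max_length S x)"
  shows "(\<Oplus>\<^bsub>F\<^esub>i\<in>S. c i \<otimes>\<^bsub>F\<^esub> lab (block r (max_length S x) (x i) p)) =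
    (\<Oplus>\<^bsub>F\<^esub>i\<in>S. c i \<otimes>\<^bsub>F\<^esub> lab (block r (max_length S x) (y i) p))"
proof -
  interpret field F using lab by (simp add: field_labelling_def)
  define L where "L = max_length S x"
  have L: "max_length S y = L" unfolding L_def using len by (intro max_length_cong) simp
  have bij: "bij_betw lab {b. length b = r} (carrier F)" using lab by (simp add: field_labelling_def)
  define s where "s z p = (\<Oplus>\<^bsub>F\<^esub>i\<in>S. c i \<otimes>\<^bsub>F\<^esub> lab (block r L (z i) p))" for z p
  have s_cl: "s z p \<in> carrier F" if "p < num_blocks r L" for z p
    unfolding s_def using c bij_betw_apply[OF bij] length_block[OF that]
    by (intro finsum_closed) auto
  let ?u = "inv_into {b. length b = r} lab"
  have "length (?u (s z p)) = r" if "p < num_blocks r L" for z p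
    using inv_into_into[of "s z p" lab "{b. length b = r}"] s_cl[OF that] bij
    by (simp add: bij_betw_def)
  moreover have "concat (map (\<lambda>p. ?u (s x p)) [0..<num_blocks r L]) =
      concat (map (\<lambda>p. ?u (s y p)) [0..<num_blocks r L])"
    using eq by (simp add: linear_combination_def L L_def[symmetric] s_def)
  ultimately have u: "?u (s x p) = ?u (s y p)"
    using p by (intro concat_map_cancel[where f = "\<lambda>p. ?u (s x p)" and xs = "[0..<num_blocks r L]"])
      (simp_all add: L_def)
  have p': "p < num_blocks r L" using p by (simp add: L_def)
  have "s x p = s y p"
    using bij_betw_imp_inj_on[OF bij_betw_inv_into[OF bij]] u s_cl[OF p'] s_cl[OF p'] by (rule inj_onD)
  then show ?thesis by (simp only: s_def L_def)
qed

text \<open>The messages of \<open>S - {k}\<close> solve a linear system without kernel, and user \<open>k\<close> can produce its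
  own message.\<close>

lemma linear_combinations_determine_messages:
  fixes F :: "'f ring" (structure)
  assumes lab: "field_labelling r F lab" and dec: "decodable_coefficients K F c"
    and c: "c \<in> coefficient_functions K F" and S: "S \<in> groups K" "k \<in> S"
    and eq: "\<And>j. j < card S - 1 \<Longrightarrow> linear_combination r F lab S (\<lambda>i. c (S, j, i)) x =
       linear_combination r F lab S (\<lambda>i. c (S, j, i)) y"
    and len: "\<And>i. i \<in> S \<Longrightarrow> length (x i) = length (y i)"
    and own: "x k = y k" and i: "i \<in> S"
  shows "x i = y i"
proof (cases "i = k")
  case False
  have F: "field F" using lab by (simp add: field_labelling_def)
  interpret field F by (rule F)
  have fS: "finite S" by (rule groups_finite[OF S(1)])
  define L where "L = max_length S x"
  have bij: "bij_betw lab {b. length b = r} (carrier F)" using lab by (simp add: field_labelling_def)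
  show ?thesis
  proof (rule blocks_cancel[OF field_labelling_pos[OF lab] len[OF i]])
    show "length (x i) \<le> L" unfolding L_def by (rule length_le_max_length[OF fS i])
    fix p assume p: "p < num_blocks r L"
    define a b where "a i = lab (block r L (x i) p)" and "b i = lab (block r L (y i) p)" for i
    have cl: "a i \<in> carrier F" "b i \<in> carrier F" for i
      using bij_betw_apply[OF bij] length_block[OF p] by (auto simp: a_def b_def)
    have ab: "a i \<ominus> b i \<oplus> b i = a i" for i using cl by (simp add: minus_eq a_assoc l_neg)
    note c_cl = coefficient_functions_closed[OF F c]
    have "(\<Oplus>i\<in>S - {k}. c (S, j, i) \<otimes> (a i \<ominus> b i)) = \<zero>" if j: "j < card S - 1" for j
    proof -
      have sum_eq: "(\<Oplus>i\<in>S. c (S, j, i) \<otimes> a i) = (\<Oplus>i\<in>S. c (S, j, i) \<otimes> b i)"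
        using linear_combination_cancel[OF lab eq[OF j] len c_cl] p by (simp add: a_def b_def L_def)
      have insert: "(\<Oplus>i\<in>S. c (S, j, i) \<otimes> z i) =
          (\<Oplus>i\<in>S - {k}. c (S, j, i) \<otimes> z i) \<oplus> c (S, j, k) \<otimes> z k" if "\<And>i. z i \<in> carrier F" for z
      proof -
        have "(\<Oplus>i\<in>insert k (S - {k}). c (S, j, i) \<otimes> z i) =
            c (S, j, k) \<otimes> z k \<oplus> (\<Oplus>i\<in>S - {k}. c (S, j, i) \<otimes> z i)"
          using fS by (intro finsum_insert funcsetI m_closed c_cl that) auto
        also have "\<dots> = (\<Oplus>i\<in>S - {k}. c (S, j, i) \<otimes> z i) \<oplus> c (S, j, k) \<otimes> z k"
          by (intro a_comm finsum_closed funcsetI m_closed c_cl that)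
        finally show ?thesis using S(2) by (simp only: insert_Diff)
      qed
      have sum_cl: "(\<Oplus>i\<in>S - {k}. c (S, j, i) \<otimes> z i) \<in> carrier F" if "\<And>i. z i \<in> carrier F" for z
        by (intro finsum_closed funcsetI m_closed c_cl that)
      \<comment> \<open>The own message of user \<open>k\<close> contributes the same term to both
        sums, so column \<open>k\<close> cancels.\<close>
      have "a k = b k" using own by (simp add: a_def b_def)
      then have "(\<Oplus>i\<in>S - {k}. c (S, j, i) \<otimes> a i) \<oplus> c (S, j, k) \<otimes> b k =
          (\<Oplus>i\<in>S - {k}. c (S, j, i) \<otimes> b i) \<oplus> c (S, j, k) \<otimes> b k"
        using sum_eq insert[of a, OF cl(1)] insert[of b, OF cl(2)] by simp
      then have rest: "(\<Oplus>i\<in>S - {k}. c (S, j, i) \<otimes> a i) = (\<Oplus>i\<in>S - {k}. c (S, j, i) \<otimes> b i)"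
        using add.right_cancel[OF m_closed[OF c_cl cl(2)] sum_cl[of a, OF cl(1)] sum_cl[of b, OF cl(2)]]
        by blast
      have "(\<Oplus>i\<in>S - {k}. c (S, j, i) \<otimes> (a i \<ominus> b i)) \<oplus> (\<Oplus>i\<in>S - {k}. c (S, j, i) \<otimes> b i) =
          (\<Oplus>i\<in>S - {k}. c (S, j, i) \<otimes> (a i \<ominus> b i) \<oplus> c (S, j, i) \<otimes> b i)"
        by (intro finsum_addf[symmetric] funcsetI m_closed minus_closed c_cl cl)
      also have "\<dots> = (\<Oplus>i\<in>S - {k}. c (S, j, i) \<otimes> a i)"
      proof (rule finsum_cong')
        fix i
        show "c (S, j, i) \<otimes> (a i \<ominus> b i) \<oplus> c (S, j, i) \<otimes> b i = c (S, j, i) \<otimes> a i"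
          by (subst r_distr[symmetric]) (simp_all add: minus_closed c_cl cl ab)
      qed (intro funcsetI m_closed c_cl cl refl)+
      finally show ?thesis
        unfolding rest using sum_cl[of b, OF cl(2)] sum_cl[of "\<lambda>i. a i \<ominus> b i", OF minus_closed[OF cl]]
        by (simp only: add.r_cancel_one)
    qed
    moreover have "(\<lambda>i. a i \<ominus> b i) \<in> S - {k} \<rightarrow> carrier F" using cl by auto
    ultimately have "\<forall>i\<in>S - {k}. a i \<ominus> b i = \<zero>"
      using dec S unfolding decodable_coefficients_def by blast
    then have "a i = b i" using i False ab[of i] cl by simp
    then show "block r L (x i) p = block r L (y i) p"
      using length_block[OF p] unfolding a_def b_def by (intro inj_onD[OF bij_betw_imp_inj_on[OF bij]]) auto
  qed
qed (simp add: own)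

section \<open>Segments, messages and the decoder\<close>

lemma segment_subset_stored:
  assumes "even_segmentation K U seg" "S \<in> groups K" "k \<in> S" "i \<in> S - {k}" "i' \<in> S - {k}"
  shows "seg S k i \<subseteq> U i'"
  using assms unfolding even_segmentation_def exclusive_files_def by blast

lemma segment_finite:
  assumes "even_segmentation K U seg" "\<forall>k\<in>{1..K}. U k \<subseteq> {1..N}" "S \<in> groups K" "k \<in> S" "i \<in> S - {k}"
  shows "finite (seg S k i)"
proof -
  have "i \<in> {1..K}" using assms(3,5) by (auto simp: groups_def)
  then show ?thesis
    using segment_subset_stored[OF assms(1,3-5,5)] assms(2) by (meson finite_atLeastAtMost finite_subset)
qed

lemma segment_bits_cong:
  assumes "\<And>n. n \<in> seg S k i \<Longrightarrow> v k n = v' k n" "finite (seg S k i)"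
  shows "segment_bits seg v S k i = segment_bits seg v' S k i"
  unfolding segment_bits_def using assms by (metis (no_types, lifting) map_cong set_sorted_list_of_set)

lemma length_segment_bits:
  assumes "finite (seg S k i)" "\<And>n. length (v k n) = T"
  shows "length (segment_bits seg v S k i) = card (seg S k i) * T"
  using assms unfolding segment_bits_def by (subst length_concat_map_const) auto

text \<open>Blanking out what user \<open>i\<close> cannot compute changes nothing: user
  \<open>i\<close> stores every file of the segments that it combines.\<close>

lemma uplink_message_eq:
  assumes "even_segmentation K U seg" "\<forall>k\<in>{1..K}. U k \<subseteq> {1..N}" "S \<in> groups K" "i \<in> S"
  shows "uplink_message K U seg v S i = padded_xor (S - {i}) (\<lambda>k. segment_bits seg v S k i)"
  unfolding uplink_message_def
proof (intro padded_xor_cong segment_bits_cong)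
  fix k n assume k: "k \<in> S - {i}"
  then have "k \<in> {1..K}" using assms(3) by (auto simp: groups_def)
  show "finite (seg S k i)" using k assms by (intro segment_finite) auto
  show "local_values K U i v k n = v k n" if "n \<in> seg S k i"
    using segment_subset_stored[OF assms(1,3), of k i i] k assms(4) that \<open>k \<in> {1..K}\<close>
    by (auto simp: local_values_def)
qed

text \<open>The length is fixed by the segment sizes and \<open>T\<close>, whatever the values are.
  This aligns the messages of two datasets during decoding and also yields the loads.\<close>

lemma length_uplink_message:
  assumes "even_segmentation K U seg" "\<forall>k\<in>{1..K}. U k \<subseteq> {1..N}" "S \<in> groups K" "i \<in> S"
    and "\<And>k n. length (v k n) = T"
  shows "length (uplink_message K U seg v S i) = Max ((\<lambda>k. card (seg S k i) * T) ` (S - {i}))"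
proof -
  have "length (segment_bits seg v S k i) = card (seg S k i) * T" if "k \<in> S - {i}" for k
    using that assms by (intro length_segment_bits segment_finite) auto
  then have "(\<lambda>k. length (segment_bits seg v S k i)) ` (S - {i}) = (\<lambda>k. card (seg S k i) * T) ` (S - {i})"
    by (intro image_cong) auto
  then show ?thesis by (simp add: uplink_message_eq[OF assms(1-4)] max_length_def)
qed

text \<open>The decoder picks any dataset that explains its observations \<open>f w\<close> and
  \<open>h w\<close>; by assumption all such datasets agree on the wanted values. Decoding thus
  reduces to comparing two datasets with the same observations.\<close>

lemma ex_decoder:
  assumes "\<And>w w'. f w = f w' \<Longrightarrow> h w = h w' \<Longrightarrow> \<forall>n\<in>A. v w n = v w' n"
  shows "\<exists>dec. \<forall>w. \<forall>n\<in>A. dec (f w) (h w) n = v w n"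
proof (intro exI allI ballI)
  fix w n assume n: "n \<in> A"
  let ?w = "SOME w'. f w' = f w \<and> h w' = h w"
  have "f ?w = f w \<and> h ?w = h w" by (rule someI[of _ w]) simp
  then show "(\<lambda>a b. v (SOME w'. f w' = a \<and> h w' = b)) (f w) (h w) n = v w n"
    using assms[of ?w w] n by blast
qed

lemma decodable_user_recovers:
  assumes lab: "field_labelling r F lab" and dec: "decodable_coefficients K F c"
    and c: "c \<in> coefficient_functions K F" and U: "\<forall>k\<in>{1..K}. U k \<subseteq> {1..N}"
    and seg: "even_segmentation K U seg" and len: "\<And>n x y. length (g n x y) = T"
    and k: "k \<in> {1..K}"
  shows "user_recovers K r F lab seg U c g d k"
  unfolding user_recovers_def
proof (rule ex_decoder, rule ballI)
  fix w w' n
  let ?v = "intermediate_values g d w" and ?v' = "intermediate_values g d w'"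
  assume bc: "broadcast K r F lab seg U c ?v = broadcast K r F lab seg U c ?v'"
    and lv: "local_values K U k ?v = local_values K U k ?v'"
    and n: "n \<in> available_files K U"
  have known: "?v q n = ?v' q n" if "q \<in> {1..K}" "n \<in> U k" for q n
    using fun_cong[OF fun_cong[OF lv, of q], of n] that by (simp add: local_values_def)
  have len_v: "length (?v q n) = T" "length (?v' q n) = T" for q n
    by (simp_all add: intermediate_values_def len)
  show "?v k n = ?v' k n"
  proof (cases "n \<in> U k")
    case True
    then show ?thesis using known k by simp
  next
    case False
    \<comment> \<open>\<open>W\<close> consists of all users that store \<open>n\<close> and is
      nonempty because \<open>n\<close> is available. Hence \<open>S\<close> is the group in which
      the value for \<open>n\<close> is delivered to user \<open>k\<close>.\<close>
    define W where "W = {i \<in> {1..K}. n \<in> U i}"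
    define S where "S = insert k W"
    have W: "k \<notin> W" "W \<noteq> {}" "finite W" "W \<subseteq> {1..K}"
      using False n by (auto simp: W_def available_files_def)
    have S: "S \<in> groups K" "k \<in> S" "S - {k} = W"
    proof -
      have "card S = Suc (card W)" "card W > 0" using W by (simp_all add: S_def card_gt_0_iff)
      then show "S \<in> groups K" using W k by (auto simp: groups_def S_def)
    qed (use W in \<open>auto simp: S_def\<close>)
    have fS: "finite S" by (rule groups_finite[OF S(1)])
    have SK: "S \<subseteq> {1..K}" using S(1) by (simp add: groups_def)
    have "n \<in> exclusive_files K U (S - {k})" unfolding S(3) by (auto simp: exclusive_files_def W_def)
    moreover have "(\<Union>i\<in>S - {k}. seg S k i) = exclusive_files K U (S - {k})"
      using seg S(1,2) by (simp add: even_segmentation_def)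
    ultimately obtain i where i: "i \<in> S - {k}" and ni: "n \<in> seg S k i"
      by blast
    let ?x = "uplink_message K U seg ?v S" and ?y = "uplink_message K U seg ?v' S"
    have "?x i = ?y i"
    proof (rule linear_combinations_determine_messages[OF lab dec c S(1,2)])
      show "linear_combination r F lab S (\<lambda>i. c (S, j, i)) ?x =
          linear_combination r F lab S (\<lambda>i. c (S, j, i)) ?y" if "j < card S - 1" for j
        using fun_cong[OF fun_cong[OF bc, of S], of j] that S(1)
        by (simp add: broadcast_def downlink_message_def)
      show "length (?x i) = length (?y i)" if "i \<in> S" for i
        by (simp only: length_uplink_message[OF seg U S(1) that, of ?v T, OF len_v(1)]
            length_uplink_message[OF seg U S(1) that, of ?v' T, OF len_v(2)])
      \<comment> \<open>User \<open>k\<close> builds its own message from its local values, which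
        agree for the two datasets.\<close>
      show "?x k = ?y k" by (simp add: uplink_message_def lv)
      show "i \<in> S" using i by simp
    qed
    then have xor: "padded_xor (S - {i}) (\<lambda>q. segment_bits seg ?v S q i) =
        padded_xor (S - {i}) (\<lambda>q. segment_bits seg ?v' S q i)"
      using i by (simp add: uplink_message_eq[OF seg U S(1)])
    have fin: "finite (seg S q i)" if "q \<in> S - {i}" for q
      using that i by (intro segment_finite[OF seg U S(1)]) auto
    have "segment_bits seg ?v S k i = segment_bits seg ?v' S k i"
    proof (rule padded_xor_cancel[OF _ _ xor])
      show "segment_bits seg ?v S q i = segment_bits seg ?v' S q i" if q: "q \<in> S - {i} - {k}" for q
      proof (rule segment_bits_cong)
        fix n assume "n \<in> seg S q i"
        \<comment> \<open>A segment needed by \<open>q\<close> consists of files stored by all of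
          \<open>S - {q}\<close>, and this set contains \<open>k\<close>.\<close>
        then have "n \<in> U k" using segment_subset_stored[OF seg S(1), of q i k] q i S(2) by auto
        then show "?v q n = ?v' q n" using known q SK by auto
      qed (use fin q in auto)
      show "length (segment_bits seg ?v S k i) = length (segment_bits seg ?v' S k i)"
        using fin[of k] i S(2) len_v by (simp add: length_segment_bits[where T = T])
    qed (use fS i S(2) in auto)
    then show ?thesis
      unfolding segment_bits_def
      by (rule concat_map_cancel) (use fin[of k] i S(2) ni len_v in auto)
  qed
qed

section \<open>Loads\<close>

lemma exclusive_files_eq_stored_exactly_by:
  assumes "W \<subseteq> {1..K}" "W \<noteq> {}" "\<forall>k\<in>{1..K}. U k \<subseteq> {1..N}"
  shows "exclusive_files K U W = stored_exactly_by K N U W"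
  using assms unfolding exclusive_files_def stored_exactly_by_def by blast

lemma information_loss_eq:
  "information_loss K N U = real (card (stored_exactly_by K N U {})) / real N"
proof -
  have "{1..N} - available_files K U = stored_exactly_by K N U {}"
    unfolding available_files_def stored_exactly_by_def by blast
  then show ?thesis by (simp add: information_loss_def)
qed

text \<open>Sizes that differ pairwise by at most 1 differ from their average by at most 1.\<close>

lemma card_segment_approx:
  assumes seg: "even_segmentation K U seg" and U: "\<forall>k\<in>{1..K}. U k \<subseteq> {1..N}"
    and S: "S \<in> groups K" "k \<in> S" "i \<in> S - {k}"
  shows "\<bar>real (card (seg S k i)) - real (card (exclusive_files K U (S - {k}))) / real (card S - 1)\<bar> \<le> 1"
proof -
  let ?m = "card S - 1" and ?e = "card (exclusive_files K U (S - {k}))"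
  have fS: "finite S" and cS: "2 \<le> card S" using groups_finite[OF S(1)] S(1) by (simp_all add: groups_def)
  have m: "card (S - {k}) = ?m" using S fS by simp
  have un: "(\<Union>i\<in>S - {k}. seg S k i) = exclusive_files K U (S - {k})"
    and disj: "disjoint_family_on (seg S k) (S - {k})"
    and even: "\<And>i j. i \<in> S - {k} \<Longrightarrow> j \<in> S - {k} \<Longrightarrow> card (seg S k i) \<le> card (seg S k j) + 1"
    using seg S(1,2) by (simp_all add: even_segmentation_def)
  have "card (\<Union>i\<in>S - {k}. seg S k i) = (\<Sum>i\<in>S - {k}. card (seg S k i))"
    using fS disj segment_finite[OF seg U S(1,2)]
    by (intro card_UN_disjoint) (simp_all add: disjoint_family_on_def)
  then have e: "?e = (\<Sum>i\<in>S - {k}. card (seg S k i))" by (simp add: un)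
  \<comment> \<open>The evenness condition is summed over \<open>j\<close> in both directions, with
    the segment of \<open>i\<close> held fixed.\<close>
  have "?e \<le> (\<Sum>j\<in>S - {k}. card (seg S k i) + 1)"
    unfolding e using S(3) by (intro sum_mono even)
  moreover have "(\<Sum>j\<in>S - {k}. card (seg S k i)) \<le> (\<Sum>j\<in>S - {k}. card (seg S k j) + 1)"
    using S(3) by (intro sum_mono even)
  ultimately have "?e \<le> ?m * (card (seg S k i) + 1)" "?m * card (seg S k i) \<le> ?e + ?m"
    unfolding sum.distrib e[symmetric] sum_constant m by (simp_all add: algebra_simps)
  then have "real ?e \<le> real (?m * (card (seg S k i) + 1))" "real (?m * card (seg S k i)) \<le> real (?e + ?m)"
    unfolding of_nat_le_iff .
  moreover have "0 < real ?m" using cS by simp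
  moreover have "\<bar>c - e / m\<bar> \<le> 1" if "e \<le> m * (c + 1)" "m * c \<le> e + m" "0 < m" for c e m :: real
    using that by (simp add: abs_le_iff field_simps)
  ultimately show ?thesis unfolding of_nat_mult of_nat_add of_nat_1 by blast
qed

text \<open>The limiting size of one segment in a group of \<open>s\<close> users, as a fraction of
  \<open>N\<close>: the files exclusive to \<open>s - 1\<close> users are shared among
  \<open>s - 1\<close> segments.\<close>

definition segment_fraction :: "nat \<Rightarrow> real \<Rightarrow> nat \<Rightarrow> real" where
  "segment_fraction K \<mu> s = \<mu> ^ (s - 1) * (1 - \<mu>) ^ (K - (s - 1)) / real (s - 1)"

text \<open>The first conjunct holds on the whole support of the placement law; it is bundled in so
  that this single predicate supplies everything the deterministic estimates need about
  \<open>U\<close>.\<close>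

definition typical_placement :: "nat \<Rightarrow> real \<Rightarrow> nat \<Rightarrow> real \<Rightarrow> placement \<Rightarrow> bool" where
  "typical_placement K \<mu> N \<delta> U \<longleftrightarrow>
     (\<forall>k\<in>{1..K}. U k \<subseteq> {1..N}) \<and>
     (\<forall>W\<in>Pow {1..K}. \<bar>real (card (stored_exactly_by K N U W)) / real N
        - \<mu> ^ card W * (1 - \<mu>) ^ (K - card W)\<bar> \<le> \<delta>)"

text \<open>The error \<open>\<delta>\<close> stems from the random number of exclusive files and
  \<open>1 / real N\<close> from the rounding in the split. Division by \<open>card S - 1\<close>,
  which is at least 1, does not enlarge the former.\<close>

lemma card_segment_fraction:
  assumes seg: "even_segmentation K U seg" and U: "typical_placement K \<mu> N \<delta> U"
    and S: "S \<in> groups K" "k \<in> S" "i \<in> S - {k}" and N: "0 < N"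
  shows "\<bar>real (card (seg S k i)) / real N - segment_fraction K \<mu> (card S)\<bar> \<le> \<delta> + 1 / real N"
proof -
  have sub: "\<forall>k\<in>{1..K}. U k \<subseteq> {1..N}" using U by (simp add: typical_placement_def)
  let ?m = "real (card S - 1)" and ?e = "real (card (exclusive_files K U (S - {k})))"
  let ?p = "\<mu> ^ (card S - 1) * (1 - \<mu>) ^ (K - (card S - 1))"
  have fS: "finite S" and cS: "2 \<le> card S" using groups_finite[OF S(1)] S(1) by (simp_all add: groups_def)
  have m: "1 \<le> ?m" using cS by simp
  have W: "S - {k} \<subseteq> {1..K}" "S - {k} \<noteq> {}" "card (S - {k}) = card S - 1"
    using S fS by (auto simp: groups_def)
  have e: "\<bar>?e / real N - ?p\<bar> \<le> \<delta>"
  proof -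
    have "\<bar>real (card (stored_exactly_by K N U (S - {k}))) / real N
        - \<mu> ^ card (S - {k}) * (1 - \<mu>) ^ (K - card (S - {k}))\<bar> \<le> \<delta>"
      using U W(1) unfolding typical_placement_def by blast
    then show ?thesis by (simp only: W(3) exclusive_files_eq_stored_exactly_by[OF W(1,2) sub])
  qed
  have "\<bar>real (card (seg S k i)) / real N - ?e / ?m / real N\<bar> = \<bar>real (card (seg S k i)) - ?e / ?m\<bar> / real N"
    unfolding diff_divide_distrib[symmetric] by simp
  also have "\<dots> \<le> 1 / real N"
    by (intro divide_right_mono card_segment_approx[OF seg sub S]) simp
  finally have a: "\<bar>real (card (seg S k i)) / real N - ?e / ?m / real N\<bar> \<le> 1 / real N" .
  have "?e / ?m / real N - segment_fraction K \<mu> (card S) = (?e / real N - ?p) / ?m"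
    by (simp add: segment_fraction_def diff_divide_distrib del: of_nat_diff)
  then have "\<bar>?e / ?m / real N - segment_fraction K \<mu> (card S)\<bar> = \<bar>?e / real N - ?p\<bar> / ?m"
    by simp
  also have "\<dots> \<le> \<bar>?e / real N - ?p\<bar>"
    using divide_left_mono[OF m, of "\<bar>?e / real N - ?p\<bar>"] m by simp
  finally have b: "\<bar>?e / ?m / real N - segment_fraction K \<mu> (card S)\<bar> \<le> \<bar>?e / real N - ?p\<bar>" .
  have "\<bar>x - z\<bar> \<le> \<delta> + u" if "\<bar>x - y\<bar> \<le> u" "\<bar>y - z\<bar> \<le> e" "e \<le> \<delta>" for x y z u e :: real
    using that by linarith
  from this[OF a b e] show ?thesis .
qed

text \<open>The padded length is attained by one of the segments, so the estimate for a single
  segment carries over and zero-padding adds no error.\<close>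

lemma uplink_message_fraction:
  assumes seg: "even_segmentation K U seg" and U: "typical_placement K \<mu> N \<delta> U"
    and S: "S \<in> groups K" "i \<in> S" and N: "0 < N" and T: "0 < T" and len: "\<And>k n. length (v k n) = T"
  shows "\<bar>real (length (uplink_message K U seg v S i)) / (real N * real T)
    - segment_fraction K \<mu> (card S)\<bar> \<le> \<delta> + 1 / real N"
proof -
  have sub: "\<forall>k\<in>{1..K}. U k \<subseteq> {1..N}" using U by (simp add: typical_placement_def)
  have fS: "finite S" and cS: "2 \<le> card S" using groups_finite[OF S(1)] S(1) by (simp_all add: groups_def)
  have "card (S - {i}) \<noteq> 0" using S fS cS by simp
  then have ne: "S - {i} \<noteq> {}" by force
  have "Max ((\<lambda>k. card (seg S k i) * T) ` (S - {i})) \<in> (\<lambda>k. card (seg S k i) * T) ` (S - {i})"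
    using ne fS by (intro Max_in) auto
  then obtain k where k: "k \<in> S - {i}"
    and l: "length (uplink_message K U seg v S i) = card (seg S k i) * T"
    using length_uplink_message[where v = v and T = T, OF seg sub S len] by auto
  have "i \<in> S - {k}" "k \<in> S" using S k by auto
  then show ?thesis
    using card_segment_fraction[OF seg U S(1) _ _ N] T unfolding l by simp
qed

lemma length_linear_combination:
  assumes lab: "field_labelling r F lab" and c: "\<And>i. c i \<in> carrier F"
  shows "length (linear_combination r F lab S c x) = num_blocks r (max_length S x) * r"
proof -
  interpret field F using lab by (simp add: field_labelling_def)
  have bij: "bij_betw lab {b. length b = r} (carrier F)" using lab by (simp add: field_labelling_def)
  define L where "L = max_length S x"
  have "length (inv_into {b. length b = r} lab (\<Oplus>\<^bsub>F\<^esub>i\<in>S. c i \<otimes>\<^bsub>F\<^esub> lab (block r L (x i) p))) = r"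
    if p: "p < num_blocks r L" for p
  proof -
    have "(\<Oplus>\<^bsub>F\<^esub>i\<in>S. c i \<otimes>\<^bsub>F\<^esub> lab (block r L (x i) p)) \<in> carrier F"
      using bij_betw_apply[OF bij] length_block[OF p]
      by (intro finsum_closed funcsetI m_closed c) simp
    then show ?thesis using bij_betw_apply[OF bij_betw_inv_into[OF bij]] by blast
  qed
  then show ?thesis
    unfolding linear_combination_def Let_def L_def[symmetric]
    by (subst length_concat_map_const[where l = r]) auto
qed

text \<open>A combination is as long as the longest uplink message of its group, rounded up to whole
  blocks. The rounding adds at most \<open>r\<close> bits, which is at most
  \<open>real r / real N\<close> after normalisation because \<open>T\<close> is at least 1.\<close>

lemma broadcast_fraction:
  assumes lab: "field_labelling r F lab" and c: "c \<in> coefficient_functions K F"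
    and seg: "even_segmentation K U seg" and U: "typical_placement K \<mu> N \<delta> U"
    and S: "S \<in> groups K" "j < card S - 1" and N: "0 < N" and T: "0 < T"
    and len: "\<And>k n. length (v k n) = T"
  shows "\<bar>real (length (broadcast K r F lab seg U c v S j)) / (real N * real T)
    - segment_fraction K \<mu> (card S)\<bar> \<le> \<delta> + 1 / real N + real r / real N"
proof -
  have F: "field F" using lab by (simp add: field_labelling_def)
  let ?x = "uplink_message K U seg v S"
  have fS: "finite S" and cS: "2 \<le> card S" using groups_finite[OF S(1)] S(1) by (simp_all add: groups_def)
  have "S \<noteq> {}" using cS by auto
  then have "max_length S ?x \<in> (\<lambda>i. length (?x i)) ` S"
    unfolding max_length_def using fS by (intro Max_in) auto
  then obtain i where i: "i \<in> S" and L: "max_length S ?x = length (?x i)" by auto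
  have b: "length (broadcast K r F lab seg U c v S j) = num_blocks r (length (?x i)) * r"
    using S length_linear_combination[OF lab coefficient_functions_closed[OF F c], of S "\<lambda>i. (S, j, i)" ?x]
    by (simp add: broadcast_def downlink_message_def L)
  let ?l = "real (length (?x i))" and ?n = "real (length (broadcast K r F lab seg U c v S j))"
  have "?l \<le> ?n" "?n \<le> ?l + real r"
    unfolding b of_nat_add[symmetric] of_nat_le_iff by (rule le_num_blocks_times[OF field_labelling_pos[OF lab]])+
  then have "?l / (real N * real T) \<le> ?n / (real N * real T)"
    "?n / (real N * real T) \<le> ?l / (real N * real T) + real r / (real N * real T)"
    unfolding add_divide_distrib[symmetric] by (intro divide_right_mono; simp)+
  moreover have "real r / (real N * real T) \<le> real r / real N"
    using N T by (intro divide_left_mono) auto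
  moreover have "\<bar>?l / (real N * real T) - segment_fraction K \<mu> (card S)\<bar> \<le> \<delta> + 1 / real N"
    by (rule uplink_message_fraction[OF seg U S(1) i N T len])
  ultimately show ?thesis by linarith
qed

section \<open>Summation over the groups by size\<close>

lemma sum_groups:
  "(\<Sum>S\<in>groups K. f (card S)) = (\<Sum>j=1..K - 1. real (K choose (j + 1)) * f (j + 1))"
proof -
  have "groups K = (\<Union>j\<in>{1..K - 1}. {S. S \<subseteq> {1..K} \<and> card S = j + 1})"
  proof (intro equalityI subsetI)
    fix S assume S: "S \<in> groups K"
    then have "S \<subseteq> {1..K}" "2 \<le> card S" by (auto simp: groups_def)
    moreover have "card S \<le> K" using card_mono[of "{1..K}" S] \<open>S \<subseteq> {1..K}\<close> by simp
    ultimately show "S \<in> (\<Union>j\<in>{1..K - 1}. {S. S \<subseteq> {1..K} \<and> card S = j + 1})"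
      by (intro UN_I[of "card S - 1"]) auto
  qed (auto simp: groups_def)
  then have "(\<Sum>S\<in>groups K. f (card S)) =
      (\<Sum>j=1..K - 1. \<Sum>S | S \<subseteq> {1..K} \<and> card S = j + 1. f (card S))"
    by (simp only:) (rule sum.UNION_disjoint; auto)
  also have "\<dots> = (\<Sum>j=1..K - 1. \<Sum>S | S \<subseteq> {1..K} \<and> card S = j + 1. f (j + 1))"
    by (intro sum.cong) auto
  also have "\<dots> = (\<Sum>j=1..K - 1. real (K choose (j + 1)) * f (j + 1))"
    by (intro sum.cong refl) (subst sum_constant, subst n_subsets, auto)
  finally show ?thesis .
qed

text \<open>A group of size \<open>j + 1\<close> sends \<open>j + 1\<close> messages, each carrying
  the denominator \<open>j\<close> of its segment size; this is the factor
  \<open>(j + 1) / j\<close>.\<close>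

lemma coded_uplink_load_eq:
  "coded_uplink_load K \<mu> = (\<Sum>S\<in>groups K. \<Sum>i\<in>S. segment_fraction K \<mu> (card S))"
proof -
  have "(\<Sum>S\<in>groups K. \<Sum>i\<in>S. segment_fraction K \<mu> (card S)) =
      (\<Sum>S\<in>groups K. (\<lambda>s. real s * segment_fraction K \<mu> s) (card S))"
    by simp
  also have "\<dots> = (\<Sum>j=1..K - 1. real (K choose (j + 1)) * (\<lambda>s. real s * segment_fraction K \<mu> s) (j + 1))"
    by (rule sum_groups)
  also have "\<dots> = coded_uplink_load K \<mu>"
    unfolding coded_uplink_load_def by (intro sum.cong) (auto simp: segment_fraction_def)
  finally show ?thesis by simp
qed

text \<open>Here the number \<open>j\<close> of combinations for a group of size
  \<open>j + 1\<close> cancels the denominator of the segment size.\<close>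

lemma coded_downlink_load_eq:
  "coded_downlink_load K \<mu> = (\<Sum>S\<in>groups K. \<Sum>j<card S - 1. segment_fraction K \<mu> (card S))"
proof -
  have "(\<Sum>S\<in>groups K. \<Sum>j<card S - 1. segment_fraction K \<mu> (card S)) =
      (\<Sum>S\<in>groups K. (\<lambda>s. real (s - 1) * segment_fraction K \<mu> s) (card S))"
    by simp
  also have "\<dots> = (\<Sum>j=1..K - 1. real (K choose (j + 1)) * (\<lambda>s. real (s - 1) * segment_fraction K \<mu> s) (j + 1))"
    by (rule sum_groups)
  also have "\<dots> = coded_downlink_load K \<mu>"
    unfolding coded_downlink_load_def by (intro sum.cong) (auto simp: segment_fraction_def)
  finally show ?thesis by simp
qed

lemma abs_double_sum_diff_le:
  fixes f :: "'a \<Rightarrow> 'b \<Rightarrow> real"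
  assumes "\<And>S i. S \<in> A \<Longrightarrow> i \<in> B S \<Longrightarrow> \<bar>f S i - q S\<bar> \<le> e"
  shows "\<bar>(\<Sum>S\<in>A. \<Sum>i\<in>B S. f S i) - (\<Sum>S\<in>A. \<Sum>i\<in>B S. q S)\<bar> \<le> (\<Sum>S\<in>A. real (card (B S))) * e"
proof -
  have "\<bar>(\<Sum>S\<in>A. \<Sum>i\<in>B S. f S i) - (\<Sum>S\<in>A. \<Sum>i\<in>B S. q S)\<bar> = \<bar>\<Sum>S\<in>A. \<Sum>i\<in>B S. f S i - q S\<bar>"
    by (simp only: sum_subtractf)
  also have "\<dots> \<le> (\<Sum>S\<in>A. \<Sum>i\<in>B S. \<bar>f S i - q S\<bar>)"
    by (intro order_trans[OF sum_abs] sum_mono sum_abs)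
  also have "\<dots> \<le> (\<Sum>S\<in>A. \<Sum>i\<in>B S. e)" by (intro sum_mono assms)
  also have "\<dots> = (\<Sum>S\<in>A. real (card (B S))) * e" by (simp add: sum_distrib_right)
  finally show ?thesis .
qed

lemma uplink_load_approx:
  assumes "even_segmentation K U seg" "typical_placement K \<mu> N \<delta> U" "0 < N" "0 < T"
    "\<And>k n. length (v k n) = T"
  shows "\<bar>uplink_load K N T U seg v - coded_uplink_load K \<mu>\<bar>
    \<le> (\<Sum>S\<in>groups K. real (card S)) * (\<delta> + 1 / real N)"
proof -
  have "uplink_load K N T U seg v =
      (\<Sum>S\<in>groups K. \<Sum>i\<in>S. real (length (uplink_message K U seg v S i)) / (real N * real T))"
    by (simp add: uplink_load_def sum_divide_distrib)
  then show ?thesis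
    unfolding coded_uplink_load_eq
    by (simp only:) (intro abs_double_sum_diff_le uplink_message_fraction assms)
qed

lemma downlink_load_approx:
  assumes "field_labelling r F lab" "c \<in> coefficient_functions K F"
    "even_segmentation K U seg" "typical_placement K \<mu> N \<delta> U" "0 < N" "0 < T"
    "\<And>k n. length (v k n) = T"
  shows "\<bar>downlink_load K N T (broadcast K r F lab seg U c v) - coded_downlink_load K \<mu>\<bar>
    \<le> (\<Sum>S\<in>groups K. real (card S - 1)) * (\<delta> + 1 / real N + real r / real N)"
proof -
  have "downlink_load K N T (broadcast K r F lab seg U c v) = (\<Sum>S\<in>groups K. \<Sum>j\<in>{..<card S - 1}.
      real (length (broadcast K r F lab seg U c v S j)) / (real N * real T))"
    by (simp add: downlink_load_def sum_divide_distrib)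
  moreover have "\<bar>(\<Sum>S\<in>groups K. \<Sum>j\<in>{..<card S - 1}.
        real (length (broadcast K r F lab seg U c v S j)) / (real N * real T)) - coded_downlink_load K \<mu>\<bar>
      \<le> (\<Sum>S\<in>groups K. real (card {..<card S - 1})) * (\<delta> + 1 / real N + real r / real N)"
    unfolding coded_downlink_load_eq
    by (intro abs_double_sum_diff_le broadcast_fraction assms) simp_all
  ultimately show ?thesis by simp
qed

section \<open>Convergence in probability\<close>

lemma prob_typical_placement_tendsto_1:
  assumes "0 < \<mu>" "\<mu> < 1" "0 < \<delta>"
  shows "(\<lambda>N. measure_pmf.prob (placement_pmf K \<mu> N)
      ({U. typical_placement K \<mu> N \<delta> U} \<inter> set_pmf (placement_pmf K \<mu> N))) \<longlonglongrightarrow> 1"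
proof -
  have "{U. typical_placement K \<mu> N \<delta> U} \<inter> set_pmf (placement_pmf K \<mu> N) =
      {U. \<forall>W\<in>Pow {1..K}. \<bar>real (card (stored_exactly_by K N U W)) / real N
        - \<mu> ^ card W * (1 - \<mu>) ^ (K - card W)\<bar> \<le> \<delta>} \<inter> set_pmf (placement_pmf K \<mu> N)" for N
    using set_placement_pmf_subset[OF assms(2)] unfolding typical_placement_def by blast
  then show ?thesis
    using prob_stored_fractions_tendsto_1[OF assms, of K] by (simp only: measure_Int_set_pmf)
qed

theorem theorem2:
  fixes K T :: nat and \<mu> :: real
    and g :: "nat \<Rightarrow> nat \<Rightarrow> 'd \<Rightarrow> 'w \<Rightarrow> bool list"
    and d :: "nat \<Rightarrow> nat \<Rightarrow> 'd"
    and seg :: "nat \<Rightarrow> placement \<Rightarrow> segmentation"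
    and r :: "nat \<Rightarrow> nat"
    and F :: "nat \<Rightarrow> 'f ring"
    and lab :: "nat \<Rightarrow> bool list \<Rightarrow> 'f"
  assumes K: "K \<ge> 1" and \<mu>: "1 / real K \<le> \<mu>" "\<mu> < 1" and T: "T \<ge> 1"
    and map_bits: "\<And>N n x y. length (g N n x y) = T"
    and seg: "\<And>N U. (\<forall>k\<in>{1..K}. U k \<subseteq> {1..N}) \<Longrightarrow> even_segmentation K U (seg N U)"
    and field: "\<And>N. field_labelling (r N) (F N) (lab N)"
    and field_size: "filterlim r at_top sequentially"
    and block_size: "(\<lambda>N. real (r N) / real N) \<longlonglongrightarrow> 0"
  shows "\<forall>\<epsilon>>0.
    (\<lambda>N. measure_pmf.prob (pair_pmf (placement_pmf K \<mu> N) (coefficients_pmf K (F N)))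
       {(U, c).
          (\<forall>k\<in>{1..K}. user_recovers K (r N) (F N) (lab N) (seg N U) U c (g N) (d N) k) \<and>
          \<bar>information_loss K N U - (1 - \<mu>) ^ K\<bar> \<le> \<epsilon> \<and>
          (\<forall>w. \<bar>uplink_load K N T U (seg N U) (intermediate_values (g N) (d N) w)
                 - coded_uplink_load K \<mu>\<bar> \<le> \<epsilon>) \<and>
          (\<forall>w. \<bar>downlink_load K N T
                    (broadcast K (r N) (F N) (lab N) (seg N U) U c
                      (intermediate_values (g N) (d N) w))
                 - coded_downlink_load K \<mu>\<bar> \<le> \<epsilon>)})
    \<longlonglongrightarrow> 1"
proof (intro allI impI)
  fix \<epsilon> :: real assume \<epsilon>: "0 < \<epsilon>"
  have \<mu>0: "0 < \<mu>"
  proof -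
    have "0 < 1 / real K" using K by simp
    then show ?thesis using \<mu>(1) by (rule less_le_trans)
  qed
  define C where "C = (\<Sum>S\<in>groups K. real (card S))"
  \<comment> \<open>The factor 2 leaves room for a second error of size \<open>\<delta>\<close> from
    rounding. With \<open>C + 1\<close> in the denominator, \<open>C \<ge> 0\<close> suffices for
    \<open>\<delta>\<close> to be positive and at most \<open>\<epsilon>\<close>.\<close>
  define \<delta> where "\<delta> = \<epsilon> / (2 * (C + 1))"
  have C: "0 \<le> C" by (simp add: C_def sum_nonneg)
  have \<delta>: "0 < \<delta>" using \<epsilon> C by (simp add: \<delta>_def)
  have C\<delta>: "C * (2 * \<delta>) \<le> \<epsilon>" using \<epsilon> C by (simp add: \<delta>_def field_simps)
  have \<delta>\<epsilon>: "\<delta> \<le> \<epsilon>"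
    using \<epsilon> C mult_nonneg_nonneg[of \<epsilon> C] by (simp add: \<delta>_def field_simps)
  \<comment> \<open>Intersecting with the support does not change the probability but makes
    \<open>P N\<close> countable, as the product rule for pairs requires. In the same way
    \<open>Q N\<close> is a subset of a finite set.\<close>
  define P where "P N = {U. typical_placement K \<mu> N \<delta> U} \<inter> set_pmf (placement_pmf K \<mu> N)" for N
  define Q where "Q N = {c. decodable_coefficients K (F N) c} \<inter> coefficient_functions K (F N)" for N
  let ?PQ = "\<lambda>N. pair_pmf (placement_pmf K \<mu> N) (coefficients_pmf K (F N))"
  let ?G = "\<lambda>N. {(U, c).
          (\<forall>k\<in>{1..K}. user_recovers K (r N) (F N) (lab N) (seg N U) U c (g N) (d N) k) \<and>
          \<bar>information_loss K N U - (1 - \<mu>) ^ K\<bar> \<le> \<epsilon> \<and>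
          (\<forall>w. \<bar>uplink_load K N T U (seg N U) (intermediate_values (g N) (d N) w)
                 - coded_uplink_load K \<mu>\<bar> \<le> \<epsilon>) \<and>
          (\<forall>w. \<bar>downlink_load K N T
                    (broadcast K (r N) (F N) (lab N) (seg N U) U c
                      (intermediate_values (g N) (d N) w))
                 - coded_downlink_load K \<mu>\<bar> \<le> \<epsilon>)}"
  have prod: "measure_pmf.prob (?PQ N) (P N \<times> Q N) =
      measure_pmf.prob (placement_pmf K \<mu> N) (P N) * measure_pmf.prob (coefficients_pmf K (F N)) (Q N)" for N
  proof (rule measure_pmf_prob_product)
    show "countable (P N)" unfolding P_def by (intro countable_Int2 countable_set_pmf)
    have "field (F N)" using field[of N] by (simp add: field_labelling_def)
    then have "finite (coefficient_functions K (F N))"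
      using field_labelling_card_carrier(2)[OF field] by (rule coefficient_functions_finite(1))
    then show "countable (Q N)" unfolding Q_def by (intro countable_Int2 countable_finite)
  qed
  have "(\<lambda>N. measure_pmf.prob (placement_pmf K \<mu> N) (P N) * measure_pmf.prob (coefficients_pmf K (F N)) (Q N))
      \<longlonglongrightarrow> 1 * 1"
    unfolding P_def Q_def
    by (intro tendsto_mult prob_typical_placement_tendsto_1 \<mu>0 \<mu>(2) \<delta>
        prob_decodable_tendsto_1[OF field field_size])
  then have lower: "(\<lambda>N. measure_pmf.prob (?PQ N) (P N \<times> Q N)) \<longlonglongrightarrow> 1"
    by (simp add: prod)
  have "(\<lambda>N. 1 / real N + real (r N) / real N) \<longlonglongrightarrow> 0 + 0"
    by (intro tendsto_add block_size lim_1_over_n)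
  \<comment> \<open>From here on the uneven splits and the padding to blocks together cost less than
    \<open>\<delta>\<close> per message.\<close>
  then have "\<forall>\<^sub>F N in sequentially. 1 / real N + real (r N) / real N < \<delta>"
    using \<delta> by (intro order_tendstoD(2)[of _ 0]) simp_all
  \<comment> \<open>The inclusion is deterministic: a typical placement with decodable coefficients
    meets all four requirements, for every dataset at once.\<close>
  then have sub: "\<forall>\<^sub>F N in sequentially. P N \<times> Q N \<subseteq> ?G N"
    using eventually_gt_at_top[of 0]
  proof eventually_elim
    case (elim N)
    show ?case
    proof (clarify, intro conjI allI ballI)
      fix U c assume U: "U \<in> P N" and c: "c \<in> Q N"
      have typical: "typical_placement K \<mu> N \<delta> U" using U by (simp add: P_def)
      then have stored: "\<forall>k\<in>{1..K}. U k \<subseteq> {1..N}" by (simp add: typical_placement_def)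
      note even = seg[OF stored]
      have cf: "c \<in> coefficient_functions K (F N)" and dec: "decodable_coefficients K (F N) c"
        using c by (simp_all add: Q_def)
      have T0: "0 < T" using T by simp
      have len: "length (intermediate_values (g N) (d N) w k n) = T" for w k n
        by (simp add: intermediate_values_def map_bits)
      show "user_recovers K (r N) (F N) (lab N) (seg N U) U c (g N) (d N) k" if "k \<in> {1..K}" for k
        by (rule decodable_user_recovers[OF field dec cf stored even map_bits that])
      show "\<bar>information_loss K N U - (1 - \<mu>) ^ K\<bar> \<le> \<epsilon>"
      proof -
        \<comment> \<open>The information loss is the case \<open>W = {}\<close> of the typicality
          bound.\<close>
        have "\<bar>information_loss K N U - \<mu> ^ card ({}::nat set) * (1 - \<mu>) ^ (K - card ({}::nat set))\<bar> \<le> \<delta>"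
          using typical unfolding typical_placement_def information_loss_eq by blast
        then show ?thesis using \<delta>\<epsilon> by simp
      qed
      show "\<bar>uplink_load K N T U (seg N U) (intermediate_values (g N) (d N) w) - coded_uplink_load K \<mu>\<bar> \<le> \<epsilon>" for w
      proof -
        have "0 \<le> real (r N) / real N" by simp
        then have "C * (\<delta> + 1 / real N) \<le> C * (2 * \<delta>)"
          using elim(1) C by (intro mult_left_mono) linarith+
        then show ?thesis
          using uplink_load_approx[where v = "intermediate_values (g N) (d N) w", OF even typical elim(2) T0 len] C\<delta> by (simp add: C_def)
      qed
      show "\<bar>downlink_load K N T (broadcast K (r N) (F N) (lab N) (seg N U) U c
          (intermediate_values (g N) (d N) w)) - coded_downlink_load K \<mu>\<bar> \<le> \<epsilon>" for w
      proof -
        \<comment> \<open>Since \<open>card S - 1 \<le> card S\<close>, the constant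
          \<open>C\<close> chosen for the uplink serves the downlink as well.\<close>
        have "(\<Sum>S\<in>groups K. real (card S - 1)) * (\<delta> + 1 / real N + real (r N) / real N) \<le> C * (2 * \<delta>)"
          unfolding C_def using elim \<delta> by (intro mult_mono sum_mono sum_nonneg) auto
        then show ?thesis
          using downlink_load_approx[where v = "intermediate_values (g N) (d N) w", OF field cf even typical elim(2) T0 len] C\<delta> by linarith
      qed
    qed
  qed
  show "(\<lambda>N. measure_pmf.prob (?PQ N) (?G N)) \<longlonglongrightarrow> 1"
  proof (rule tendsto_sandwich[OF _ _ lower tendsto_const])
    show "\<forall>\<^sub>F N in sequentially. measure_pmf.prob (?PQ N) (P N \<times> Q N) \<le> measure_pmf.prob (?PQ N) (?G N)"
      using sub by eventually_elim (intro measure_pmf.finite_measure_mono; simp)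
  qed simp
qed

end
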